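(* Let $T>0$, let $v_0:\mathbb{R}\to\mathbb{R}$ be Lipschitz continuous, and let $H:\mathbb{R}\to\mathbb{R}$ be a $W^{2,\infty}$ function, in the sense that $H''\in L^\infty(\mathbb{R})$, such that $H''(p)\ge m_H>0$ for some constant $m_H$. Let $v$ be the viscosity solution of $$v_t(t,x)+H(\partial_x v(t,x))=0 \ \text{ in } (0,T)\times\mathbb{R},\qquad v(0,x)=v_0(x) \ \text{ on } \mathbb{R}.$$ Let $R[\cdot]$ be the one-dimensional $\mathsf{CWENO}$ or $\mathsf{CWENOZ}$ reconstruction defined in the context, with linear coefficients $d_L=d_R=d>0$ and $d_0=1-2d>0$. Assume $$\frac{1}{1-2d}\,C_3+\frac{2d}{1-2d}\,C_2<1,$$ where $C_2=1/8$ and $C_3\approx 0.2533$ are the constants described in the context; that is, approximately, $d\lesssim 0.332$ (in particular $d=1/8$ is admissible). Then: (i) There is a constant $C<1$ such that, for every Lipschitz continuous function $w$ on $\mathbb{R}$, with $W=(w_j)_j$, $w_j=w(x_j)$, and $R_1[W]$ the piecewise linear interpolant of $W$, one has $R[W](x_k)=w(x_k)$ for all $k$ and $$|R[W](x)-R_1[W](x)|\le C\max_{x_k\in(x-2\Delta x,\,x+2\Delta x)}|w_{k+1}-2w_k+w_{k-1}|.$$ (ii) Consequently, if $\Delta x=\mathcal{O}(\Delta t^2)$, the numerical solution $U^n=(u^n_j)_{j\in\mathbb{Z}}$ of the semi-Lagrangian scheme defined in the context satisfies $$\|R[U^n]-v(n\Delta t,\cdot)\|_\infty\to 0\qquad\text{for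 } 0\le n\le T/\Delta t,\ \text{ as }\Delta t\to 0.$$
   Context: **Grid.** For $\Delta x>0$, $\Delta t>0$ let $x_j=j\Delta x$ ($j\in\mathbb{Z}$) and $t_n=n\Delta t$. **Reconstruction $R$.** Let $U=(u_j)_{j\in\mathbb{Z}}$ be a real sequence and $x\in[x_j,x_{j+1}]$. Let $Q$ be the cubic polynomial interpolating $u_{j-1},u_j,u_{j+1},u_{j+2}$ at $x_{j-1},x_j,x_{j+1},x_{j+2}$. Let $P_L$ (resp. $P_R$) be the polynomial of degree at most 2 interpolating $u_{j-1},u_j,u_{j+1}$ at $x_{j-1},x_j,x_{j+1}$ (resp. $u_j,u_{j+1},u_{j+2}$ at $x_j,x_{j+1},x_{j+2}$). With $d_L=d_R=d$ and $d_0=1-2d$, set $$P_0=\frac{1}{d_0}\,(Q-d_LP_L-d_RP_R).$$ The oscillation indicator of a polynomial $P$ of degree at most 3 on this cell is $$\mathrm{I}[P]=\sum_{\alpha\ge 2}\Delta x^{2\alpha-3}\int_{x_j}^{x_{j+1}}\Big(\frac{d^\alpha P}{dx^\alpha}\Big)^2dx,$$ and $\mathrm{I}_0=\mathrm{I}[Q]$, $\mathrm{I}_L=\mathrm{I}[P_L]$, $\mathrm{I}_R=\mathrm{I}[P_R]$. Let $l\ge1$ and let $\epsilon$ be a small positive quantity (for instance $l=2$, $\epsilon=\Delta x^2$). For $k\in\{0,L,R\}$ the nonlinear weights are $\omega_k=\alpha_k/(\alpha_0+\alpha_L+\alpha_R)$, where - $\mathsf{CWENO}$: $\alpha_k=\dfrac{d_k}{(\mathrm{I}_k+\epsilon)^l}$;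 - $\mathsf{CWENOZ}$: $\alpha_k=d_k\Big(1+\big(\tfrac{\tau}{\mathrm{I}_k+\epsilon}\big)^l\Big)$ with $\tau=|2\mathrm{I}_0-\mathrm{I}_L-\mathrm{I}_R|$. The reconstruction is $R[U](x)=\omega_0P_0(x)+\omega_LP_L(x)+\omega_RP_R(x)$ for $x\in[x_j,x_{j+1}]$. All the polynomials involved interpolate the data at $x_j$ and $x_{j+1}$, so $R[U](x_j)=u_j$. **Constants $C_2$, $C_3$.** $C_r$ denotes the constant in the inequality of part (i) when $R$ is replaced by Lagrange interpolation of degree $r$: for $x$ in the cell $[x_j,x_{j+1}]$, $|P_L-R_1|$ and $|P_R-R_1|$ are bounded by $C_2$ times, and $|Q-R_1|$ by $C_3$ times, the maximum of the absolute second differences appearing there. It is known (Ferretti) that $C_2=1/8$ and $C_3\approx0.2533$. **Scheme.** Let $H^*(a)=\sup_{p\in\mathbb{R}}(ap-H(p))$ be the Legendre transform of $H$. By Fenchel duality $H(\partial_xv(t,x))=\sup_{a\in\mathbb{R}}\{a\,\partial_xv(t,x)-H^*(a)\}$, and the supremum can be restricted to a suitable compact set $A\subset\mathbb{R}$, which is fixed. The equation is thus recast as a Hamilton–Jacobi–Bellman equation with Hamiltonian $\max_{a\in A}(-f_D(a)\,p-f_C(a))$, with dynamics $f_D(a)=-a$ and running cost $f_C(a)=H^*(a)$. The characteristics are discretized by a $\nu$-stage Runge–Kutta method with weights $b_1,\dots,b_\nu$, and the cost integral by the quadrature rule with the same weights, where $(b_k)$ is one of $(1)$ (forward Euler), $(\tfrac12,\tfrac12)$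 (Heun/trapezoidal), $(\tfrac16,\tfrac23,\tfrac16)$ (third order Runge–Kutta/Simpson). The scheme is $u^0_j=v_0(x_j)$ and, for $n\ge0$, $j\in\mathbb{Z}$, $$u^{n+1}_j=\min_{(a_1,\dots,a_\nu)\in A^\nu}\Big\{R[U^n]\Big(x_j-\Delta t\sum_{k=1}^\nu b_ka_k\Big)+\Delta t\sum_{k=1}^\nu b_k H^*(a_k)\Big\}.$$ *)

theory Defs
  imports "HOL-Analysis.Analysis" "HOL-Library.Landau_Symbols"
    "HOL-Computational_Algebra.Polynomial"
begin

section \<open>Reconstruction on a uniform grid\<close>

definition node :: "real \<Rightarrow> int \<Rightarrow> real" where
  "node dx j = of_int j * dx"

text \<open>The polynomial of least degree through the points (node dx k, u k), k in the stencil S.\<close>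

definition interp_poly :: "real \<Rightarrow> (int \<Rightarrow> real) \<Rightarrow> int set \<Rightarrow> real poly" where
  "interp_poly dx u S = (THE p. degree p < card S \<and> (\<forall>k\<in>S. poly p (node dx k) = u k))"

definition poly_Q :: "real \<Rightarrow> (int \<Rightarrow> real) \<Rightarrow> int \<Rightarrow> real poly" where
  "poly_Q dx u j = interp_poly dx u {j-1, j, j+1, j+2}"

definition poly_L :: "real \<Rightarrow> (int \<Rightarrow> real) \<Rightarrow> int \<Rightarrow> real poly" where
  "poly_L dx u j = interp_poly dx u {j-1, j, j+1}"

definition poly_R :: "real \<Rightarrow> (int \<Rightarrow> real) \<Rightarrow> int \<Rightarrow> real poly" where
  "poly_R dx u j = interp_poly dx u {j, j+1, j+2}"

definition poly_lin :: "real \<Rightarrow> (int \<Rightarrow> real) \<Rightarrow> int \<Rightarrow> real poly" where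
  "poly_lin dx u j = interp_poly dx u {j, j+1}"

definition poly_0 :: "real \<Rightarrow> real \<Rightarrow> (int \<Rightarrow> real) \<Rightarrow> int \<Rightarrow> real poly" where
  "poly_0 d dx u j =
     smult (1 / (1 - 2*d)) (poly_Q dx u j - smult d (poly_L dx u j) - smult d (poly_R dx u j))"

text \<open>Only polynomials of degree at most 3 occur, so derivatives of order above 3 vanish.\<close>

definition osc_ind :: "real \<Rightarrow> int \<Rightarrow> real poly \<Rightarrow> real" where
  "osc_ind dx j P =
     (\<Sum>\<alpha>=2..3. dx ^ (2*\<alpha> - 3) *
        integral {node dx j..node dx (j+1)} (\<lambda>x. (poly ((pderiv ^^ \<alpha>) P) x)\<^sup>2))"

datatype cweno_kind = CWENO | CWENOZ

datatype stencil = St0 | StL | StR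

fun lin_weight :: "real \<Rightarrow> stencil \<Rightarrow> real" where
  "lin_weight d St0 = 1 - 2*d"
| "lin_weight d StL = d"
| "lin_weight d StR = d"

fun ind :: "real \<Rightarrow> (int \<Rightarrow> real) \<Rightarrow> int \<Rightarrow> stencil \<Rightarrow> real" where
  "ind dx u j St0 = osc_ind dx j (poly_Q dx u j)"
| "ind dx u j StL = osc_ind dx j (poly_L dx u j)"
| "ind dx u j StR = osc_ind dx j (poly_R dx u j)"

definition tau :: "real \<Rightarrow> (int \<Rightarrow> real) \<Rightarrow> int \<Rightarrow> real" where
  "tau dx u j = \<bar>2 * ind dx u j St0 - ind dx u j StL - ind dx u j StR\<bar>"

text \<open>The exponent l is a real number; all bases below are nonnegative, and 0 powr l = 0
  agrees with the usual convention because l is at least 1.\<close>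

fun raw_weight ::
  "cweno_kind \<Rightarrow> real \<Rightarrow> real \<Rightarrow> real \<Rightarrow> real \<Rightarrow> (int \<Rightarrow> real) \<Rightarrow> int \<Rightarrow> stencil \<Rightarrow> real" where
  "raw_weight CWENO d l \<epsilon> dx u j k = lin_weight d k / (ind dx u j k + \<epsilon>) powr l"
| "raw_weight CWENOZ d l \<epsilon> dx u j k =
     lin_weight d k * (1 + (tau dx u j / (ind dx u j k + \<epsilon>)) powr l)"

definition weight ::
  "cweno_kind \<Rightarrow> real \<Rightarrow> real \<Rightarrow> real \<Rightarrow> real \<Rightarrow> (int \<Rightarrow> real) \<Rightarrow> int \<Rightarrow> stencil \<Rightarrow> real" where
  "weight kind d l \<epsilon> dx u j k =
     raw_weight kind d l \<epsilon> dx u j k /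
       (raw_weight kind d l \<epsilon> dx u j St0 + raw_weight kind d l \<epsilon> dx u j StL
         + raw_weight kind d l \<epsilon> dx u j StR)"

definition recon_cell ::
  "cweno_kind \<Rightarrow> real \<Rightarrow> real \<Rightarrow> real \<Rightarrow> real \<Rightarrow> (int \<Rightarrow> real) \<Rightarrow> int \<Rightarrow> real \<Rightarrow> real" where
  "recon_cell kind d l \<epsilon> dx u j x =
     weight kind d l \<epsilon> dx u j St0 * poly (poly_0 d dx u j) x
     + weight kind d l \<epsilon> dx u j StL * poly (poly_L dx u j) x
     + weight kind d l \<epsilon> dx u j StR * poly (poly_R dx u j) x"

text \<open>The floor selects the cell containing x. At a node it selects the cell to the right; the
  cell to the left gives the same value there, since all polynomials interpolate the data.\<close>

definition recon ::
  "cweno_kind \<Rightarrow> real \<Rightarrow> real \<Rightarrow> real \<Rightarrow> real \<Rightarrow> (int \<Rightarrow> real) \<Rightarrow> real \<Rightarrow> real" where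
  "recon kind d l \<epsilon> dx u x = recon_cell kind d l \<epsilon> dx u \<lfloor>x / dx\<rfloor> x"

definition lin_interp :: "real \<Rightarrow> (int \<Rightarrow> real) \<Rightarrow> real \<Rightarrow> real" where
  "lin_interp dx u x = poly (poly_lin dx u \<lfloor>x / dx\<rfloor>) x"

definition max_second_diff :: "real \<Rightarrow> (int \<Rightarrow> real) \<Rightarrow> real \<Rightarrow> real" where
  "max_second_diff dx u x =
     Max ((\<lambda>k. \<bar>u (k+1) - 2 * u k + u (k-1)\<bar>) ` {k. node dx k \<in> {x - 2*dx<..<x + 2*dx}})"

text \<open>C is a constant \<open>C\<^sub>2\<close> (resp. \<open>C\<^sub>3\<close>) for the quadratic (resp. cubic) Lagrange
  interpolation on a cell.\<close>

definition quadratic_const :: "real \<Rightarrow> bool" where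
  "quadratic_const C \<longleftrightarrow> (\<forall>dx>0. \<forall>u j. \<forall>x\<in>{node dx j..node dx (j+1)}.
     \<bar>poly (poly_L dx u j) x - poly (poly_lin dx u j) x\<bar> \<le> C * max_second_diff dx u x \<and>
     \<bar>poly (poly_R dx u j) x - poly (poly_lin dx u j) x\<bar> \<le> C * max_second_diff dx u x)"

definition cubic_const :: "real \<Rightarrow> bool" where
  "cubic_const C \<longleftrightarrow> (\<forall>dx>0. \<forall>u j. \<forall>x\<in>{node dx j..node dx (j+1)}.
     \<bar>poly (poly_Q dx u j) x - poly (poly_lin dx u j) x\<bar> \<le> C * max_second_diff dx u x)"

lemma interp_poly_eq:
  assumes dx: "dx > 0" and deg: "degree p < card S"
    and val: "\<And>k. k \<in> S \<Longrightarrow> poly p (node dx k) = u k"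
  shows "interp_poly dx u S = p"
  unfolding interp_poly_def
proof (rule the_equality)
  show "degree p < card S \<and> (\<forall>k\<in>S. poly p (node dx k) = u k)"
    using deg val by blast
next
  fix q assume q: "degree q < card S \<and> (\<forall>k\<in>S. poly q (node dx k) = u k)"
  show "q = p"
  proof (rule ccontr)
    assume "q \<noteq> p"
    then have nz: "q - p \<noteq> 0" by simp
    have inj: "inj_on (node dx) S"
      using dx by (auto simp: inj_on_def node_def)
    have "node dx ` S \<subseteq> {x. poly (q - p) x = 0}"
      using q val by auto
    then have "card (node dx ` S) \<le> card {x. poly (q - p) x = 0}"
      using poly_roots_finite[OF nz] by (rule card_mono[rotated])
    also have "\<dots> \<le> degree (q - p)" by (rule card_poly_roots_bound[OF nz])
    also have "\<dots> < card S" using q deg by (auto intro: degree_diff_less)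
    finally show False by (simp add: card_image[OF inj])
  qed
qed

lemma interp_poly_local:
  assumes dx: "dx > 0" and deg: "degree P < card S"
    and val: "\<And>k. k \<in> S \<Longrightarrow> poly P (of_int (k - j)) = u k"
  shows "poly (interp_poly dx u S) x = poly P (x / dx - of_int j)"
proof -
  let ?p = "pcompose P [:- of_int j, 1 / dx:]"
  have "interp_poly dx u S = ?p"
  proof (rule interp_poly_eq[OF dx])
    show "degree ?p < card S" using deg dx by (simp add: degree_pcompose)
    show "poly ?p (node dx k) = u k" if "k \<in> S" for k
      using val[OF that] dx by (simp add: poly_pcompose node_def)
  qed
  then show ?thesis by (simp add: poly_pcompose)
qed

lemma poly_lin_explicit:
  assumes "dx > 0"
  shows "poly (poly_lin dx u j) x = u j + (x / dx - of_int j) * (u (j+1) - u j)"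
proof -
  have "poly (poly_lin dx u j) x = poly [:u j, u (j+1) - u j:] (x / dx - of_int j)"
    unfolding poly_lin_def by (rule interp_poly_local[OF assms]) (auto simp: degree_pCons_eq_if)
  then show ?thesis by simp
qed

lemma poly_L_explicit:
  assumes "dx > 0" and "\<theta> = x / dx - of_int j"
  shows "poly (poly_L dx u j) x =
    poly (poly_lin dx u j) x - \<theta> * (1 - \<theta>) / 2 * (u (j+1) - 2 * u j + u (j-1))"
proof -
  define D where "D = u (j+1) - 2 * u j + u (j-1)"
  have "poly (poly_L dx u j) x = poly [:u j, u (j+1) - u j - D/2, D/2:] \<theta>"
    unfolding poly_L_def assms(2)
    by (rule interp_poly_local[OF assms(1)]) (auto simp: degree_pCons_eq_if D_def field_simps)
  then show ?thesis
    unfolding poly_lin_explicit[OF assms(1)] D_def assms(2)[symmetric]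
    by (simp add: field_simps)
qed

lemma poly_R_explicit:
  assumes "dx > 0" and "\<theta> = x / dx - of_int j"
  shows "poly (poly_R dx u j) x =
    poly (poly_lin dx u j) x - \<theta> * (1 - \<theta>) / 2 * (u (j+2) - 2 * u (j+1) + u j)"
proof -
  define D where "D = u (j+2) - 2 * u (j+1) + u j"
  have "poly (poly_R dx u j) x = poly [:u j, u (j+1) - u j - D/2, D/2:] \<theta>"
    unfolding poly_R_def assms(2)
    by (rule interp_poly_local[OF assms(1)]) (auto simp: degree_pCons_eq_if D_def field_simps)
  then show ?thesis
    unfolding poly_lin_explicit[OF assms(1)] D_def assms(2)[symmetric]
    by (simp add: field_simps)
qed

lemma poly_Q_explicit:
  assumes "dx > 0" and "\<theta> = x / dx - of_int j"
  shows "poly (poly_Q dx u j) x =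
    poly (poly_lin dx u j) x - \<theta> * (1 - \<theta>) / 6 *
      ((2 - \<theta>) * (u (j+1) - 2 * u j + u (j-1)) + (1 + \<theta>) * (u (j+2) - 2 * u (j+1) + u j))"
proof -
  define D where "D = u (j+1) - 2 * u j + u (j-1)"
  define E where "E = u (j+2) - 2 * u (j+1) + u j"
  have "poly (poly_Q dx u j) x =
      poly [:u j, u (j+1) - u j - D/2 - (E - D)/6, D/2, (E - D)/6:] \<theta>"
    unfolding poly_Q_def assms(2)
    by (rule interp_poly_local[OF assms(1)]) (auto simp: degree_pCons_eq_if D_def E_def field_simps)
  then show ?thesis
    unfolding poly_lin_explicit[OF assms(1)] D_def E_def assms(2)[symmetric]
    by (simp add: field_simps)
qed

lemma max_second_diff_ge:
  assumes "dx > 0" and "\<bar>node dx k - x\<bar> < 2 * dx"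
  shows "\<bar>u (k+1) - 2 * u k + u (k-1)\<bar> \<le> max_second_diff dx u x"
proof -
  have "{k. node dx k \<in> {x - 2*dx<..<x + 2*dx}} \<subseteq> {\<lfloor>x/dx - 2\<rfloor>..\<lceil>x/dx + 2\<rceil>}"
  proof
    fix i assume "i \<in> {k. node dx k \<in> {x - 2*dx<..<x + 2*dx}}"
    then have "x/dx - 2 < of_int i" "of_int i < x/dx + 2"
      using assms(1) by (auto simp: node_def field_simps)
    then show "i \<in> {\<lfloor>x/dx - 2\<rfloor>..\<lceil>x/dx + 2\<rceil>}"
      unfolding atLeastAtMost_iff by linarith
  qed
  then have "finite {k. node dx k \<in> {x - 2*dx<..<x + 2*dx}}"
    by (rule finite_subset) simp
  then show ?thesis
    unfolding max_second_diff_def using assms(2) by (intro Max_ge) (auto simp: abs_less_iff)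
qed

lemma cell_bounds:
  assumes dx: "dx > 0" and x: "x \<in> {node dx j..node dx (j+1)}" and \<theta>: "\<theta> = x / dx - of_int j"
    and M: "M = max_second_diff dx u x"
  shows "0 \<le> \<theta>" "\<theta> \<le> 1" "\<theta> * (1 - \<theta>) \<le> 1/4"
    "\<bar>u (j+1) - 2 * u j + u (j-1)\<bar> \<le> M" "\<bar>u (j+2) - 2 * u (j+1) + u j\<bar> \<le> M"
proof -
  show "0 \<le> \<theta>" "\<theta> \<le> 1"
    using x dx unfolding \<theta> by (auto simp: node_def field_simps)
  have "0 \<le> (\<theta> - 1/2)\<^sup>2" by simp
  then show "\<theta> * (1 - \<theta>) \<le> 1/4" by (simp add: power2_eq_square field_simps)
  have "\<bar>node dx j - x\<bar> < 2 * dx" "\<bar>node dx (j+1) - x\<bar> < 2 * dx"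
    using x dx by (auto simp: node_def field_simps abs_less_iff)
  from this[THEN max_second_diff_ge[OF dx], of u]
  show "\<bar>u (j+1) - 2 * u j + u (j-1)\<bar> \<le> M" "\<bar>u (j+2) - 2 * u (j+1) + u j\<bar> \<le> M"
    unfolding M by (simp_all add: add.assoc)
qed

text \<open>The known values \<open>C\<^sub>2 = 1/8\<close> and \<open>C\<^sub>3 \<approx> 0.2533\<close> are constants in this sense (and so is
  \<open>C\<^sub>3 = 1/8\<close>).\<close>

lemma quadratic_constI:
  assumes "C \<ge> 1/8"
  shows "quadratic_const C"
  unfolding quadratic_const_def
proof (intro allI impI ballI)
  fix dx :: real and u j x
  assume dx: "dx > 0" and x: "x \<in> {node dx j..node dx (j+1)}"
  define \<theta> where "\<theta> = x / dx - of_int j"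
  define M where "M = max_second_diff dx u x"
  note b = cell_bounds[OF dx x \<theta>_def M_def]
  have "\<bar>\<theta> * (1 - \<theta>) / 2 * D\<bar> \<le> C * M" if "\<bar>D\<bar> \<le> M" for D
  proof -
    have "\<bar>\<theta> * (1 - \<theta>) / 2 * D\<bar> = \<theta> * (1 - \<theta>) / 2 * \<bar>D\<bar>"
      using b by (simp add: abs_mult)
    also have "\<dots> \<le> C * M"
      using b that assms by (intro mult_mono) auto
    finally show ?thesis .
  qed
  then show "\<bar>poly (poly_L dx u j) x - poly (poly_lin dx u j) x\<bar> \<le> C * max_second_diff dx u x \<and>
    \<bar>poly (poly_R dx u j) x - poly (poly_lin dx u j) x\<bar> \<le> C * max_second_diff dx u x"
    unfolding poly_L_explicit[OF dx \<theta>_def] poly_R_explicit[OF dx \<theta>_def] M_def[symmetric]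
    using b by auto
qed

lemma cubic_constI:
  assumes "C \<ge> 1/8"
  shows "cubic_const C"
  unfolding cubic_const_def
proof (intro allI impI ballI)
  fix dx :: real and u j x
  assume dx: "dx > 0" and x: "x \<in> {node dx j..node dx (j+1)}"
  define \<theta> where "\<theta> = x / dx - of_int j"
  define M where "M = max_second_diff dx u x"
  note b = cell_bounds[OF dx x \<theta>_def M_def]
  have "\<bar>(2 - \<theta>) * D + (1 + \<theta>) * E\<bar> \<le> 3 * M" if "\<bar>D\<bar> \<le> M" "\<bar>E\<bar> \<le> M" for D E
  proof -
    have "\<bar>(2 - \<theta>) * D + (1 + \<theta>) * E\<bar> \<le> (2 - \<theta>) * \<bar>D\<bar> + (1 + \<theta>) * \<bar>E\<bar>"
      using b by (intro abs_triangle_ineq[THEN order_trans]) (simp add: abs_mult)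
    also have "\<dots> \<le> (2 - \<theta>) * M + (1 + \<theta>) * M"
      using b that by (intro add_mono mult_left_mono) auto
    finally show ?thesis by (simp add: algebra_simps)
  qed
  from this[OF b(4,5)]
  have "\<bar>\<theta> * (1 - \<theta>) / 6\<bar> * \<bar>(2 - \<theta>) * (u (j+1) - 2 * u j + u (j-1))
      + (1 + \<theta>) * (u (j+2) - 2 * u (j+1) + u j)\<bar> \<le> \<bar>\<theta> * (1 - \<theta>) / 6\<bar> * (3 * M)"
    by (rule mult_left_mono) simp
  then have "\<bar>poly (poly_Q dx u j) x - poly (poly_lin dx u j) x\<bar> \<le> \<bar>\<theta> * (1 - \<theta>) / 6\<bar> * (3 * M)"
    unfolding poly_Q_explicit[OF dx \<theta>_def] abs_mult[symmetric] by simp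
  also have "\<dots> = \<theta> * (1 - \<theta>) / 6 * (3 * M)"
    using b by simp
  also have "\<dots> = \<theta> * (1 - \<theta>) / 2 * M" by simp
  also have "\<dots> \<le> C * M"
    using b assms by (intro mult_right_mono) auto
  finally show "\<bar>poly (poly_Q dx u j) x - poly (poly_lin dx u j) x\<bar> \<le> C * max_second_diff dx u x"
    unfolding M_def .
qed


section \<open>Weak derivatives on the real line\<close>

text \<open>Test functions are continuously differentiable with compact support.\<close>

definition locally_integrable :: "(real \<Rightarrow> real) \<Rightarrow> bool" where
  "locally_integrable f \<longleftrightarrow> (\<forall>a b. set_integrable lebesgue {a..b} f)"

definition weak_deriv :: "(real \<Rightarrow> real) \<Rightarrow> (real \<Rightarrow> real) \<Rightarrow> bool" where
  "weak_deriv f g \<longleftrightarrow> locally_integrable f \<and> locally_integrable g \<and>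
     (\<forall>\<phi> \<phi>'. (\<forall>x. (\<phi> has_real_derivative \<phi>' x) (at x)) \<longrightarrow> continuous_on UNIV \<phi>' \<longrightarrow>
        (\<exists>r. \<forall>x. \<bar>x\<bar> > r \<longrightarrow> \<phi> x = 0) \<longrightarrow>
        (LINT x|lebesgue. f x * \<phi>' x) = - (LINT x|lebesgue. g x * \<phi> x))"

text \<open>H is the continuous representative, H2 (a representative of) its second derivative.\<close>

definition W2_inf :: "(real \<Rightarrow> real) \<Rightarrow> (real \<Rightarrow> real) \<Rightarrow> bool" where
  "W2_inf H H2 \<longleftrightarrow> continuous_on UNIV H \<and>
     (\<exists>H1. weak_deriv H H1 \<and> weak_deriv H1 H2) \<and>
     H2 \<in> borel_measurable lebesgue \<and> (\<exists>M. AE p in lebesgue. \<bar>H2 p\<bar> \<le> M)"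


section \<open>Viscosity solutions\<close>

definition C1_on ::
  "(real \<times> real) set \<Rightarrow> (real \<times> real \<Rightarrow> real) \<Rightarrow> (real \<times> real \<Rightarrow> real) \<Rightarrow> (real \<times> real \<Rightarrow> real) \<Rightarrow> bool"
  where
  "C1_on S \<phi> \<phi>t \<phi>x \<longleftrightarrow>
     (\<forall>z\<in>S. (\<phi> has_derivative (\<lambda>h. \<phi>t z * fst h + \<phi>x z * snd h)) (at z)) \<and>
     continuous_on S \<phi>t \<and> continuous_on S \<phi>x"

definition viscosity_subsolution ::
  "real \<Rightarrow> (real \<Rightarrow> real) \<Rightarrow> (real \<Rightarrow> real \<Rightarrow> real) \<Rightarrow> bool" where
  "viscosity_subsolution T H v \<longleftrightarrow>
     (\<forall>\<phi> \<phi>t \<phi>x t x. C1_on ({0<..<T} \<times> UNIV) \<phi> \<phi>t \<phi>x \<longrightarrow> t \<in> {0<..<T} \<longrightarrow>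
        (\<forall>\<^sub>F (s, y) in at (t, x). v s y - \<phi> (s, y) \<le> v t x - \<phi> (t, x)) \<longrightarrow>
        \<phi>t (t, x) + H (\<phi>x (t, x)) \<le> 0)"

definition viscosity_supersolution ::
  "real \<Rightarrow> (real \<Rightarrow> real) \<Rightarrow> (real \<Rightarrow> real \<Rightarrow> real) \<Rightarrow> bool" where
  "viscosity_supersolution T H v \<longleftrightarrow>
     (\<forall>\<phi> \<phi>t \<phi>x t x. C1_on ({0<..<T} \<times> UNIV) \<phi> \<phi>t \<phi>x \<longrightarrow> t \<in> {0<..<T} \<longrightarrow>
        (\<forall>\<^sub>F (s, y) in at (t, x). v s y - \<phi> (s, y) \<ge> v t x - \<phi> (t, x)) \<longrightarrow>
        \<phi>t (t, x) + H (\<phi>x (t, x)) \<ge> 0)"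

text \<open>Uniform continuity is the customary class in which the viscosity solution is unique for a
  Lipschitz initial datum on the whole line (which need not be bounded); it also gives a meaning
  to v at the final time T.\<close>

definition viscosity_solution ::
  "real \<Rightarrow> (real \<Rightarrow> real) \<Rightarrow> (real \<Rightarrow> real) \<Rightarrow> (real \<Rightarrow> real \<Rightarrow> real) \<Rightarrow> bool" where
  "viscosity_solution T H v0 v \<longleftrightarrow>
     uniformly_continuous_on ({0..T} \<times> UNIV) (\<lambda>(t, x). v t x) \<and>
     viscosity_subsolution T H v \<and> viscosity_supersolution T H v \<and>
     (\<forall>x. v 0 x = v0 x)"


section \<open>The semi-Lagrangian scheme\<close>

definition legendre :: "(real \<Rightarrow> real) \<Rightarrow> real \<Rightarrow> real" where
  "legendre H a = (SUP p. a * p - H p)"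

text \<open>Weights of the forward Euler, Heun/trapezoidal and third order Runge-Kutta/Simpson rules.\<close>

definition rk_weights :: "real list set" where
  "rk_weights = {[1], [1/2, 1/2], [1/6, 2/3, 1/6]}"

text \<open>Control tuples are lists as long as the list b of weights. The minimum over the compact set
  of tuples is written as an infimum; it is attained, since the minimized function is
  continuous.\<close>

primrec sl_scheme ::
  "cweno_kind \<Rightarrow> real \<Rightarrow> real \<Rightarrow> real \<Rightarrow> (real \<Rightarrow> real) \<Rightarrow> (real \<Rightarrow> real) \<Rightarrow> real set \<Rightarrow> real list
    \<Rightarrow> real \<Rightarrow> real \<Rightarrow> nat \<Rightarrow> int \<Rightarrow> real" where
  "sl_scheme kind d l \<epsilon> H v0 A b dx dt 0 = (\<lambda>j. v0 (node dx j))"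
| "sl_scheme kind d l \<epsilon> H v0 A b dx dt (Suc n) = (\<lambda>j.
     INF a\<in>{a. length a = length b \<and> set a \<subseteq> A}.
       recon kind d l \<epsilon> dx (sl_scheme kind d l \<epsilon> H v0 A b dx dt n)
         (node dx j - dt * (\<Sum>k<length b. b ! k * a ! k))
       + dt * (\<Sum>k<length b. b ! k * legendre H (a ! k)))"

end

theory Submission
  imports Defs
begin

text \<open>
  Part (i) is a computation on one cell. At relative position \<open>\<theta>\<close> every candidate polynomial differs
  from the linear interpolant by \<open>\<theta>(1-\<theta>)/2\<close> times a combination of the two second differences of the
  stencil, hence so does the reconstruction, with two coefficients that depend on the nonlinear
  weights (\<open>recon_repr\<close>). Any admissible \<open>C\<^sub>2\<close> and \<open>C\<^sub>3\<close> are at least \<open>1/8\<close>, so the hypothesis forces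
  \<open>d < 7/18\<close>. Then the coefficients are at least \<open>-1/2\<close> and their absolute values add up to
  at most \<open>(1+2d)/(1-2d) < 8\<close>; as \<open>\<theta>(1-\<theta>) \<le> 1/4\<close>, the constant \<open>(1+2d)/(8(1-2d)) < 1\<close> is suitable.

  For part (ii) the scheme is compared with the exact evolution \<open>W\<close> given by the Hopf-Lax formula.
  The reconstruction is not monotone, but two one-sided facts replace monotonicity. At the nodes it is
  exact, so controls that lead to a node bound the numerical solution from above. From below,
  data with second differences at most \<open>\<sigma>\<close> have a reconstruction that is at least
  a neighbouring nodal value minus \<open>2\<sigma>\<close>, however concave the data are (\<open>recon_ge_node\<close>). The required
  bound on second differences is produced by the scheme: \<open>H\<close> is strongly convex with modulus \<open>m\<close>,
  so its Legendre transform is semiconcave (\<open>legendre_semiconcave\<close>), and using one foot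
  point for three adjacent nodes shows that second differences are at most \<open>\<Delta>x\<^sup>2/(m \<Delta>t)\<close> after
  one step. Each step thus commits an error \<open>O(\<Delta>x)\<close> (\<open>scheme_step\<close>), and the total error is
  \<open>O(\<Delta>x/\<Delta>t) = O(\<Delta>t)\<close> (\<open>scheme_error\<close>). The same estimates confine nearly optimal controls to a compact
  interval; Jensen's inequality reduces tuples of controls to their averages.

  Two further ingredients link this to the hypotheses. The bound on the weak second derivative of
  \<open>H\<close> is turned into strong convexity by testing with smoothed hat functions
  (\<open>W2_inf_strongly_convex\<close>). And the given viscosity solution equals \<open>W\<close> (\<open>v_eq_W\<close>): it lies below since
  it is a subsolution of every linear transport equation that supports the Hamilton-Jacobi
  equation, and above by doubling of variables.
\<close>

section \<open>The reconstruction as a perturbation of the linear interpolant\<close>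

lemma osc_ind_nonneg:
  assumes "dx > 0" shows "osc_ind dx j P \<ge> 0"
  unfolding osc_ind_def
  by (intro sum_nonneg mult_nonneg_nonneg Henstock_Kurzweil_Integration.integral_nonneg
      integrable_continuous_interval continuous_intros) (use assms in auto)

lemma raw_weight_pos:
  assumes "dx > 0" "\<epsilon> > 0" "d > 0" "1 - 2*d > 0"
  shows "raw_weight kind d l \<epsilon> dx u j k > 0"
proof -
  have lw: "lin_weight d k > 0" using assms by (cases k) auto
  have "ind dx u j k \<ge> 0" using assms osc_ind_nonneg by (cases k) auto
  then have "ind dx u j k + \<epsilon> > 0" using assms by simp
  then show ?thesis using lw
    by (cases kind) (auto intro!: mult_pos_pos add_pos_nonneg)
qed

lemma weight_convex:
  assumes "dx > 0" "\<epsilon> > 0" "d > 0" "1 - 2*d > 0"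
  shows "weight kind d l \<epsilon> dx u j k \<ge> 0"
    "weight kind d l \<epsilon> dx u j St0 + weight kind d l \<epsilon> dx u j StL + weight kind d l \<epsilon> dx u j StR = 1"
proof -
  note p = raw_weight_pos[OF assms, of kind l u j]
  show "weight kind d l \<epsilon> dx u j k \<ge> 0"
    unfolding weight_def using p[of k] p[of St0] p[of StL] p[of StR] by simp
  show "weight kind d l \<epsilon> dx u j St0 + weight kind d l \<epsilon> dx u j StL + weight kind d l \<epsilon> dx u j StR = 1"
    unfolding weight_def using p[of St0] p[of StL] p[of StR]
    by (simp add: add_divide_distrib[symmetric])
qed

text \<open>The quotient is the coefficient of a second difference in \<open>P\<^sub>0\<close>. It is negative for
  \<open>d > 1/3\<close> at one end of the cell; the bound \<open>d < 7/18\<close> keeps it above \<open>-1/2\<close>.\<close>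

lemma stencil_coeff_ge:
  fixes d \<theta> w0 w :: real
  assumes "0 < d" "d < 7/18" "0 \<le> \<theta>" "\<theta> \<le> 1" "0 \<le> w0" "w0 \<le> 1" "0 \<le> w"
  shows "- 1/2 \<le> w0 * ((2 - \<theta>) / 3 - d) / (1 - 2*d) + w"
proof -
  have "(1 - 2*d) * (- 1/2) \<le> (2 - \<theta>) / 3 - d"
    using assms by (simp add: field_simps)
  then have "- 1/2 \<le> ((2 - \<theta>) / 3 - d) / (1 - 2*d)"
    using assms by (simp add: field_simps)
  then have "w0 * (- 1/2) \<le> w0 * (((2 - \<theta>) / 3 - d) / (1 - 2*d))"
    using assms by (intro mult_left_mono) auto
  then show ?thesis using assms by simp
qed

text \<open>Relative to the linear interpolant each of \<open>Q\<close>, \<open>P\<^sub>L\<close>, \<open>P\<^sub>R\<close> is \<open>-\<theta>(1-\<theta>)/2\<close> times a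
  combination of the two second differences of the stencil, so the nonlinear weights only enter
  through the two coefficients. The bound from below is what makes the lower estimate
  \<open>recon_ge_node\<close> possible; the bound on the sum of absolute values, divided by 8, is the
  constant of part (i).\<close>

lemma recon_repr:
  assumes dx: "dx > 0" and eps: "\<epsilon> > 0" and d: "0 < d" "d < 7/18"
    and x: "x \<in> {node dx j..node dx (j+1)}" and \<theta>: "\<theta> = x / dx - of_int j"
  obtains A B where "- 1/2 \<le> A" "- 1/2 \<le> B" "\<bar>A\<bar> + \<bar>B\<bar> \<le> (1 + 2*d) / (1 - 2*d)"
    "recon_cell kind d l \<epsilon> dx u j x = poly (poly_lin dx u j) x
      - \<theta> * (1 - \<theta>) / 2 *
        (A * (u (j+1) - 2 * u j + u (j-1)) + B * (u (j+2) - 2 * u (j+1) + u j))"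
proof -
  define w0 wL wR where "w0 = weight kind d l \<epsilon> dx u j St0" and "wL = weight kind d l \<epsilon> dx u j StL"
    and "wR = weight kind d l \<epsilon> dx u j StR"
  have d2: "1 - 2*d > 0" using d by simp
  note wc = weight_convex[OF dx eps d(1) d2, of kind l u j]
  have w: "w0 \<ge> 0" "wL \<ge> 0" "wR \<ge> 0" "w0 + wL + wR = 1"
    using wc unfolding w0_def wL_def wR_def by auto
  note b = cell_bounds(1,2)[OF dx x \<theta> refl]
  define a1 a2 where "a1 = ((2 - \<theta>) / 3 - d) / (1 - 2*d)" and "a2 = ((1 + \<theta>) / 3 - d) / (1 - 2*d)"
  define A B where "A = w0 * a1 + wL" and "B = w0 * a2 + wR"
  define D E r where "D = u (j+1) - 2 * u j + u (j-1)" and "E = u (j+2) - 2 * u (j+1) + u j"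
    and "r = poly (poly_lin dx u j) x"
  have "A \<ge> - 1/2"
    unfolding A_def a1_def using stencil_coeff_ge[OF d b, of w0 wL] w by simp
  moreover have "B \<ge> - 1/2"
    unfolding B_def a2_def using stencil_coeff_ge[OF d, of "1 - \<theta>" w0 wR] w b by (simp add: algebra_simps)
  moreover have "\<bar>A\<bar> + \<bar>B\<bar> \<le> (1 + 2*d) / (1 - 2*d)"
  proof -
    have "\<bar>a1\<bar> + \<bar>a2\<bar> = (\<bar>(2 - \<theta>) / 3 - d\<bar> + \<bar>(1 + \<theta>) / 3 - d\<bar>) / (1 - 2*d)"
      using d2 by (simp add: a1_def a2_def add_divide_distrib)
    also have "\<dots> \<le> (1 + 2*d) / (1 - 2*d)"
      using d2 d b by (intro divide_right_mono) (auto simp: abs_if field_simps)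
    finally have a: "\<bar>a1\<bar> + \<bar>a2\<bar> \<le> (1 + 2*d) / (1 - 2*d)" .
    have one: "1 \<le> (1 + 2*d) / (1 - 2*d)" using d2 d by simp
    have "\<bar>A\<bar> \<le> w0 * \<bar>a1\<bar> + wL" "\<bar>B\<bar> \<le> w0 * \<bar>a2\<bar> + wR"
      unfolding A_def B_def using w by (auto simp: abs_mult intro!: abs_triangle_ineq[THEN order_trans])
    then have "\<bar>A\<bar> + \<bar>B\<bar> \<le> w0 * (\<bar>a1\<bar> + \<bar>a2\<bar>) + (wL + wR) * 1"
      by (simp add: algebra_simps)
    also have "\<dots> \<le> w0 * ((1 + 2*d) / (1 - 2*d)) + (wL + wR) * ((1 + 2*d) / (1 - 2*d))"
      using w a one by (intro add_mono mult_left_mono) auto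
    also have "\<dots> = (w0 + wL + wR) * ((1 + 2*d) / (1 - 2*d))" by (simp only: distrib_right add.assoc)
    finally show ?thesis using w by simp
  qed
  moreover have "recon_cell kind d l \<epsilon> dx u j x = r - \<theta> * (1 - \<theta>) / 2 * (A * D + B * E)"
  proof -
    define q where "q = \<theta> * (1 - \<theta>) / 2"
    have L: "poly (poly_L dx u j) x = r - q * D" and R: "poly (poly_R dx u j) x = r - q * E"
      unfolding poly_L_explicit[OF dx \<theta>] poly_R_explicit[OF dx \<theta>] r_def q_def D_def E_def by simp_all
    have Q: "poly (poly_Q dx u j) x = r - q * ((2 - \<theta>) / 3 * D + (1 + \<theta>) / 3 * E)"
      unfolding poly_Q_explicit[OF dx \<theta>] r_def q_def D_def E_def by (simp add: field_simps)
    have P0: "poly (poly_0 d dx u j) x = r - q * (a1 * D + a2 * E)"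
    proof -
      have a: "(2 - \<theta>) / 3 = (1 - 2*d) * a1 + d" "(1 + \<theta>) / 3 = (1 - 2*d) * a2 + d"
        using d2 by (simp_all add: a1_def a2_def)
      have "poly (poly_0 d dx u j) x = 1 / (1 - 2*d) * ((1 - 2*d) * (r - q * (a1 * D + a2 * E)))"
        unfolding poly_0_def poly_smult poly_diff L R Q a
        by (rule arg_cong[where f = "\<lambda>z. 1 / (1 - 2*d) * z"]) (simp add: algebra_simps)
      then show ?thesis using d2 by simp
    qed
    have "recon_cell kind d l \<epsilon> dx u j x = (w0 + wL + wR) * r - q * (A * D + B * E)"
      unfolding recon_cell_def w0_def[symmetric] wL_def[symmetric] wR_def[symmetric] L R P0 A_def B_def
      by (simp add: algebra_simps)
    then show ?thesis using w by (simp add: q_def)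
  qed
  ultimately show thesis using that unfolding D_def E_def r_def by blast
qed

lemma floor_cell:
  assumes "dx > 0"
  shows "x \<in> {node dx \<lfloor>x / dx\<rfloor>..node dx (\<lfloor>x / dx\<rfloor> + 1)}"
proof -
  have "of_int \<lfloor>x / dx\<rfloor> \<le> x / dx" "x / dx \<le> of_int (\<lfloor>x / dx\<rfloor> + 1)" by linarith+
  then show ?thesis using assms by (simp only: node_def pos_le_divide_eq pos_divide_le_eq atLeastAtMost_iff)
qed

lemma recon_node:
  assumes dx: "dx > 0" and eps: "\<epsilon> > 0" and d: "0 < d" "d < 7/18"
  shows "recon kind d l \<epsilon> dx u (node dx k) = u k"
proof -
  have k: "node dx k / dx = of_int k" using dx by (simp add: node_def)
  have "node dx k \<in> {node dx k..node dx (k+1)}" using dx by (simp add: node_def field_simps)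
  from recon_repr[OF dx eps d this refl, of kind l u]
  have "recon_cell kind d l \<epsilon> dx u k (node dx k) = poly (poly_lin dx u k) (node dx k)"
    by (metis (no_types, lifting) k diff_self mult_zero_left div_0 diff_zero)
  then show ?thesis by (simp add: recon_def k poly_lin_explicit[OF dx])
qed

lemma recon_lin_interp_dist:
  assumes dx: "dx > 0" and eps: "\<epsilon> > 0" and d: "0 < d" "d < 7/18"
  shows "\<bar>recon kind d l \<epsilon> dx u x - lin_interp dx u x\<bar>
     \<le> (1 + 2*d) / (1 - 2*d) / 8 * max_second_diff dx u x"
proof -
  define j where "j = \<lfloor>x / dx\<rfloor>"
  define \<theta> where "\<theta> = x / dx - of_int j"
  have x: "x \<in> {node dx j..node dx (j+1)}" unfolding j_def by (rule floor_cell[OF dx])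
  define M where "M = max_second_diff dx u x"
  note b = cell_bounds[OF dx x \<theta>_def M_def]
  obtain A B where AB: "- 1/2 \<le> A" "- 1/2 \<le> B" "\<bar>A\<bar> + \<bar>B\<bar> \<le> (1 + 2*d) / (1 - 2*d)"
    "recon_cell kind d l \<epsilon> dx u j x = poly (poly_lin dx u j) x
      - \<theta> * (1 - \<theta>) / 2 *
        (A * (u (j+1) - 2 * u j + u (j-1)) + B * (u (j+2) - 2 * u (j+1) + u j))"
    using recon_repr[OF dx eps d x \<theta>_def] by metis
  define D E where "D = u (j+1) - 2 * u j + u (j-1)" and "E = u (j+2) - 2 * u (j+1) + u j"
  have DE: "\<bar>D\<bar> \<le> M" "\<bar>E\<bar> \<le> M" using b unfolding D_def E_def by auto
  have "recon kind d l \<epsilon> dx u x - lin_interp dx u x = - (\<theta> * (1 - \<theta>) / 2 * (A * D + B * E))"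
    unfolding recon_def lin_interp_def j_def[symmetric] AB(4) D_def E_def by simp
  then have "\<bar>recon kind d l \<epsilon> dx u x - lin_interp dx u x\<bar> = \<theta> * (1 - \<theta>) / 2 * \<bar>A * D + B * E\<bar>"
    using b by (simp add: abs_mult)
  also have "\<dots> \<le> 1/8 * \<bar>A * D + B * E\<bar>"
    using b by (intro mult_right_mono) auto
  also have "\<bar>A * D + B * E\<bar> \<le> \<bar>A\<bar> * \<bar>D\<bar> + \<bar>B\<bar> * \<bar>E\<bar>"
    by (metis abs_mult abs_triangle_ineq)
  also have "\<dots> \<le> \<bar>A\<bar> * M + \<bar>B\<bar> * M" using DE by (intro add_mono mult_left_mono) auto
  also have "\<dots> = (\<bar>A\<bar> + \<bar>B\<bar>) * M" by (simp add: algebra_simps)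
  also have "\<dots> \<le> (1 + 2*d) / (1 - 2*d) * M" using AB(3) DE by (intro mult_right_mono) auto
  finally show ?thesis unfolding M_def by simp
qed

text \<open>A one-sided substitute for monotonicity. The reconstruction is compared with the mean of the
  linear interpolations between \<open>x\<^bsub>j-1\<^esub>, x\<^bsub>j+1\<^esub>\<close> and between \<open>x\<^sub>j, x\<^bsub>j+2\<^esub>\<close>: a very
  negative second difference pulls this mean down more than it can pull down the
  reconstruction, because the coefficients of \<open>recon_repr\<close> are at least \<open>-1/2\<close>. Hence only
  positive second differences, bounded by \<open>\<sigma>\<close>, can bring the reconstruction below all four
  nodal values.\<close>

lemma recon_ge_node:
  assumes dx: "dx > 0" and eps: "\<epsilon> > 0" and d: "0 < d" "d < 7/18"
    and semi: "\<And>k. u (k+1) - 2 * u k + u (k-1) \<le> \<sigma>" and \<sigma>: "\<sigma> \<ge> 0"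
  obtains k where "\<bar>node dx k - x\<bar> \<le> 2 * dx" "u k - 2 * \<sigma> \<le> recon kind d l \<epsilon> dx u x"
proof -
  define j where "j = \<lfloor>x / dx\<rfloor>"
  define \<theta> where "\<theta> = x / dx - of_int j"
  have x: "x \<in> {node dx j..node dx (j+1)}" unfolding j_def by (rule floor_cell[OF dx])
  note b = cell_bounds(1-3)[OF dx x \<theta>_def refl]
  obtain A B where AB: "- 1/2 \<le> A" "- 1/2 \<le> B" "\<bar>A\<bar> + \<bar>B\<bar> \<le> (1 + 2*d) / (1 - 2*d)"
    "recon_cell kind d l \<epsilon> dx u j x = poly (poly_lin dx u j) x
      - \<theta> * (1 - \<theta>) / 2 *
        (A * (u (j+1) - 2 * u j + u (j-1)) + B * (u (j+2) - 2 * u (j+1) + u j))"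
    using recon_repr[OF dx eps d x \<theta>_def] by metis
  define D E where "D = u (j+1) - 2 * u j + u (j-1)" and "E = u (j+2) - 2 * u (j+1) + u j"
  have DE: "D \<le> \<sigma>" "E \<le> \<sigma>"
    using semi[of j] semi[of "j+1"] unfolding D_def E_def by (simp_all add: add.assoc)
  have "(1 + 2*d) / (1 - 2*d) \<le> 8" using d by (simp add: field_simps)
  then have AB8: "A + B \<le> 8" using AB(3) by linarith
  \<comment> \<open>\<open>c\<close> is the mean of the two interpolations, \<open>p\<close> and \<open>q\<close> the resulting coefficients.\<close>
  define c where "c = (1-\<theta>)/4 * u (j-1) + (2-\<theta>)/4 * u j + (1+\<theta>)/4 * u (j+1) + \<theta>/4 * u (j+2)"
  define p q where "p = \<theta> * (1-\<theta>)/2 * A + (1-\<theta>)/4" and "q = \<theta> * (1-\<theta>)/2 * B + \<theta>/4"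
  have "recon kind d l \<epsilon> dx u x = c - p * D - q * E"
    unfolding recon_def j_def[symmetric] AB(4) poly_lin_explicit[OF dx] \<theta>_def[symmetric]
      c_def p_def q_def D_def E_def by (simp add: field_simps)
  moreover have "p \<ge> 0" "q \<ge> 0"
  proof -
    have "\<theta> * (1-\<theta>)/2 * (-1/2) \<le> \<theta> * (1-\<theta>)/2 * A" "\<theta> * (1-\<theta>)/2 * (-1/2) \<le> \<theta> * (1-\<theta>)/2 * B"
      using AB b by (intro mult_left_mono; simp)+
    moreover have "\<theta> * (1-\<theta>) \<le> 1 * (1-\<theta>)" "\<theta> * (1-\<theta>) \<le> \<theta> * 1"
      using b by (intro mult_right_mono mult_left_mono; simp)+
    ultimately show "p \<ge> 0" "q \<ge> 0" unfolding p_def q_def by linarith+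
  qed
  moreover have "p + q \<le> 2"
  proof -
    have "p + q = \<theta> * (1-\<theta>)/2 * (A + B) + 1/4"
      unfolding p_def q_def by (simp add: field_simps)
    also have "\<theta> * (1-\<theta>)/2 * (A + B) \<le> \<theta> * (1-\<theta>)/2 * 8"
      using AB8 b by (intro mult_left_mono) auto
    finally show ?thesis using b by simp
  qed
  ultimately have ge: "recon kind d l \<epsilon> dx u x \<ge> c - 2 * \<sigma>"
  proof -
    assume r: "recon kind d l \<epsilon> dx u x = c - p * D - q * E" and "p \<ge> 0" "q \<ge> 0" "p + q \<le> 2"
    then have "p * D + q * E \<le> p * \<sigma> + q * \<sigma>" using DE by (intro add_mono mult_left_mono)
    also have "\<dots> = (p + q) * \<sigma>" by (simp add: algebra_simps)
    also have "\<dots> \<le> 2 * \<sigma>" using \<open>p + q \<le> 2\<close> \<sigma> by (rule mult_right_mono)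
    finally show ?thesis using r by simp
  qed
  have "\<exists>k\<in>{j-1, j, j+1, j+2}. u k \<le> c"
  proof (rule ccontr)
    assume "\<not> ?thesis"
    then have gt: "u (j-1) > c" "u j > c" "u (j+1) > c" "u (j+2) > c" by auto
    have "(1-\<theta>)/4 * c \<le> (1-\<theta>)/4 * u (j-1)" "(2-\<theta>)/4 * c < (2-\<theta>)/4 * u j"
      "(1+\<theta>)/4 * c \<le> (1+\<theta>)/4 * u (j+1)" "\<theta>/4 * c \<le> \<theta>/4 * u (j+2)"
      using gt b by (intro mult_left_mono mult_strict_left_mono; simp)+
    then have "(1-\<theta>)/4 * c + (2-\<theta>)/4 * c + (1+\<theta>)/4 * c + \<theta>/4 * c < c"
      using c_def by linarith
    moreover have "(1-\<theta>)/4 * c + (2-\<theta>)/4 * c + (1+\<theta>)/4 * c + \<theta>/4 * c = c"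
      by (simp add: field_simps)
    ultimately show False by simp
  qed
  then obtain k where k: "k \<in> {j-1, j, j+1, j+2}" "u k \<le> c" by blast
  have "\<bar>node dx k - x\<bar> \<le> 2 * dx"
    using k(1) x dx by (auto simp: node_def algebra_simps abs_le_iff)
  then show thesis using that ge k(2) by simp
qed

lemma lin_interp_close:
  assumes dx: "dx > 0" and f: "L-lipschitz_on UNIV f" and E: "\<And>k. \<bar>u k - f (node dx k)\<bar> \<le> E"
  shows "\<bar>lin_interp dx u x - f x\<bar> \<le> E + L * dx"
proof -
  define j where "j = \<lfloor>x / dx\<rfloor>"
  define \<theta> where "\<theta> = x / dx - of_int j"
  have x: "x \<in> {node dx j..node dx (j+1)}" unfolding j_def by (rule floor_cell[OF dx])
  have \<theta>: "0 \<le> \<theta>" "\<theta> \<le> 1" using cell_bounds(1,2)[OF dx x \<theta>_def refl] by auto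
  have L: "L \<ge> 0" using f lipschitz_on_nonneg by blast
  have near: "\<bar>u k - f x\<bar> \<le> E + L * dx" if "k \<in> {j, j+1}" for k
  proof -
    have "dist (f (node dx k)) (f x) \<le> L * dist (node dx k) x"
      by (rule lipschitz_onD[OF f]) auto
    also have "\<dots> \<le> L * dx"
      using that x dx L by (intro mult_left_mono) (auto simp: dist_real_def node_def abs_le_iff algebra_simps)
    finally show ?thesis using E[of k] by (simp add: dist_real_def)
  qed
  have "lin_interp dx u x - f x = (1-\<theta>) * (u j - f x) + \<theta> * (u (j+1) - f x)"
    unfolding lin_interp_def j_def[symmetric] poly_lin_explicit[OF dx] \<theta>_def[symmetric]
    by (simp add: algebra_simps)
  also have "\<bar>\<dots>\<bar> \<le> (1-\<theta>) * \<bar>u j - f x\<bar> + \<theta> * \<bar>u (j+1) - f x\<bar>"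
    using \<theta> by (intro abs_triangle_ineq[THEN order_trans]) (simp add: abs_mult)
  also have "\<dots> \<le> (1-\<theta>) * (E + L * dx) + \<theta> * (E + L * dx)"
    using \<theta> near by (intro add_mono mult_left_mono) auto
  finally show ?thesis by (simp add: algebra_simps)
qed

lemma recon_close:
  assumes dx: "dx > 0" and eps: "\<epsilon> > 0" and d: "0 < d" "d < 7/18"
    and f: "L-lipschitz_on UNIV f" and E: "\<And>k. \<bar>u k - f (node dx k)\<bar> \<le> E"
  shows "\<bar>recon kind d l \<epsilon> dx u x - f x\<bar> \<le> 5 * E + 3 * L * dx"
proof -
  have L: "L \<ge> 0" using f lipschitz_on_nonneg by blast
  have snd: "\<bar>u (k+1) - 2 * u k + u (k-1)\<bar> \<le> 4 * E + 2 * L * dx" for k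
  proof -
    have "\<bar>f (node dx (k+1)) - f (node dx k)\<bar> \<le> L * dx" for k
      using lipschitz_onD[OF f, of "node dx (k+1)" "node dx k"] dx
      by (simp add: dist_real_def node_def algebra_simps)
    from this[of k] this[of "k-1"] E[of "k+1"] E[of k] E[of "k-1"]
    show ?thesis by (simp add: abs_le_iff)
  qed
  have "max_second_diff dx u x \<le> 4 * E + 2 * L * dx"
  proof -
    let ?S = "{k. node dx k \<in> {x - 2*dx<..<x + 2*dx}}"
    have "\<lfloor>x / dx\<rfloor> \<in> ?S" using floor_cell[OF dx, of x] dx by (auto simp: node_def algebra_simps)
    moreover have "?S \<subseteq> {\<lfloor>x/dx - 2\<rfloor>..\<lceil>x/dx + 2\<rceil>}"
    proof
      fix i assume "i \<in> ?S"
      then have "x/dx - 2 < of_int i" "of_int i < x/dx + 2"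
        using dx by (auto simp: node_def field_simps)
      then show "i \<in> {\<lfloor>x/dx - 2\<rfloor>..\<lceil>x/dx + 2\<rceil>}"
        unfolding atLeastAtMost_iff by linarith
    qed
    then have "finite ?S" by (rule finite_subset) simp
    ultimately show ?thesis unfolding max_second_diff_def using snd by (intro Max.boundedI) auto
  qed
  moreover define c where "c = (1 + 2*d) / (1 - 2*d) / 8"
  have c: "c \<le> 1" "c \<ge> 0"
    unfolding c_def using d by (auto simp: field_simps)
  moreover have pos: "4 * E + 2 * L * dx \<ge> 0" using snd[of 0] by linarith
  ultimately have "c * max_second_diff dx u x \<le> c * (4 * E + 2 * L * dx)"
    by (intro mult_left_mono)
  also have "\<dots> \<le> 1 * (4 * E + 2 * L * dx)" by (rule mult_right_mono[OF c(1) pos])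
  finally have "c * max_second_diff dx u x \<le> 4 * E + 2 * L * dx" by simp
  with recon_lin_interp_dist[OF dx eps d, of kind l u x, folded c_def] lin_interp_close[OF dx f E, of x]
  show ?thesis by linarith
qed

text \<open>The data \<open>k\<^sup>2/2\<close> have unit second differences, and both Lagrange interpolants reproduce
  the parabola; its distance to the chord at the midpoint of a cell is \<open>1/8\<close>.\<close>

lemma interpolation_const_ge:
  shows "quadratic_const C \<Longrightarrow> C \<ge> 1/8" "cubic_const C \<Longrightarrow> C \<ge> 1/8"
proof -
  define u :: "int \<Rightarrow> real" where "u k = (of_int k)\<^sup>2 / 2" for k
  have u2: "u (k+1) - 2 * u k + u (k-1) = 1" for k
    unfolding u_def by (simp add: power2_eq_square field_simps)
  have M: "max_second_diff 1 u (1/2) = 1"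
  proof -
    have "0 \<in> {k. node 1 k \<in> {1/2 - 2*1<..<1/2 + 2*1}}" by (simp add: node_def)
    then have "(\<lambda>k. \<bar>u (k+1) - 2 * u k + u (k-1)\<bar>) ` {k. node 1 k \<in> {1/2 - 2*1<..<1/2 + 2*1}} = {1}"
      unfolding u2 by auto
    then show ?thesis unfolding max_second_diff_def by simp
  qed
  have x: "(1/2::real) \<in> {node 1 0..node 1 (0+1)}" by (simp add: node_def)
  have u2': "u 1 - 2 * u 0 + u (- 1) = 1" "u 2 - 2 * u 1 + u 0 = 1"
    using u2[of 0] u2[of 1] by simp_all
  have "\<bar>poly (poly_L 1 u 0) (1/2) - poly (poly_lin 1 u 0) (1/2)\<bar> = 1/8"
    using poly_L_explicit[of 1 "1/2" "1/2" 0 u] u2' by simp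
  moreover have "\<bar>poly (poly_Q 1 u 0) (1/2) - poly (poly_lin 1 u 0) (1/2)\<bar> = 1/8"
    using poly_Q_explicit[of 1 "1/2" "1/2" 0 u] u2' by simp
  ultimately show "quadratic_const C \<Longrightarrow> C \<ge> 1/8" "cubic_const C \<Longrightarrow> C \<ge> 1/8"
    using x M unfolding quadratic_const_def cubic_const_def
    by (metis mult.right_neutral zero_less_one)+
qed

section \<open>Strong convexity from the weak second derivative\<close>

lemma pos_part_power_deriv:
  assumes "n > 0"
  shows "((\<lambda>x::real. max 0 x ^ Suc n) has_real_derivative real (Suc n) * max 0 x ^ n) (at x)"
proof (cases x "0::real" rule: linorder_cases)
  case less
  have "((\<lambda>x::real. 0) has_real_derivative real (Suc n) * max 0 x ^ n) (at x)"
    using less assms by (cases n) auto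
  then show ?thesis
    by (rule has_field_derivative_transform_within_open[where S = "{..<0}"]) (use less in auto)
next
  case equal
  have "isCont (\<lambda>x::real. max 0 x ^ n) 0"
    using continuous_on_eq_continuous_at[of UNIV "\<lambda>x::real. max 0 x ^ n"]
    by (auto intro!: continuous_intros)
  moreover have "max 0 z ^ Suc n = max 0 z ^ n * z" for z :: real
    using assms by (auto simp: max_def)
  ultimately show ?thesis
    unfolding CARAT_DERIV equal using assms by (intro exI[of _ "\<lambda>x. max 0 x ^ n"]) auto
next
  case greater
  have "((\<lambda>x. x ^ Suc n) has_real_derivative real (Suc n) * max 0 x ^ n) (at x)"
    using DERIV_pow[of "Suc n" x] greater by simp
  then show ?thesis
    by (rule has_field_derivative_transform_within_open[where S = "{0<..}"]) (use greater in auto)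
qed

text \<open>\<open>spline 1\<close> is the tent of mass one on \<open>[-\<eta>, \<eta>]\<close>, and \<open>spline 2\<close>, \<open>spline 3\<close> are its first
  and second antiderivatives vanishing at \<open>-\<infinity>\<close>: \<open>spline 3\<close> is a smoothing of the positive part.\<close>

definition spline :: "nat \<Rightarrow> real \<Rightarrow> real \<Rightarrow> real" where
  "spline n \<eta> x = (max 0 (x + \<eta>) ^ n - 2 * max 0 x ^ n + max 0 (x - \<eta>) ^ n) / (fact n * \<eta>\<^sup>2)"

lemma spline_deriv [derivative_intros]:
  assumes "n > 0" "(g has_real_derivative g') (at x)"
  shows "((\<lambda>x. spline (Suc n) \<eta> (g x)) has_real_derivative spline n \<eta> (g x) * g') (at x)"
proof -
  have *: "((\<lambda>x. max 0 (h x) ^ Suc n) has_real_derivative real (Suc n) * max 0 (h x) ^ n * h') (at x)"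
    if "(h has_real_derivative h') (at x)" for h h'
    using DERIV_chain2[OF pos_part_power_deriv[OF assms(1)] that] .
  have g: "((\<lambda>x. g x + c) has_real_derivative g') (at x)" for c
    using DERIV_add[OF assms(2) DERIV_const[of c]] by simp
  let ?P = "\<lambda>c x. max 0 (g x + c)"
  have "((\<lambda>x. (?P \<eta> x ^ Suc n - 2 * ?P 0 x ^ Suc n + ?P (- \<eta>) x ^ Suc n) / (fact (Suc n) * \<eta>\<^sup>2))
      has_real_derivative
      (real (Suc n) * ?P \<eta> x ^ n * g' - 2 * (real (Suc n) * ?P 0 x ^ n * g')
        + real (Suc n) * ?P (- \<eta>) x ^ n * g') / (fact (Suc n) * \<eta>\<^sup>2)) (at x)"
    by (intro DERIV_cdivide DERIV_add DERIV_diff DERIV_cmult *[OF g])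
  also have "(real (Suc n) * ?P \<eta> x ^ n * g' - 2 * (real (Suc n) * ?P 0 x ^ n * g')
        + real (Suc n) * ?P (- \<eta>) x ^ n * g') / (fact (Suc n) * \<eta>\<^sup>2)
      = (real (Suc n) * ((?P \<eta> x ^ n - 2 * ?P 0 x ^ n + ?P (- \<eta>) x ^ n) * g'))
          / (real (Suc n) * (fact n * \<eta>\<^sup>2))"
    by (simp only: fact_Suc of_nat_mult algebra_simps)
  also have "\<dots> = (?P \<eta> x ^ n - 2 * ?P 0 x ^ n + ?P (- \<eta>) x ^ n) * g' / (fact n * \<eta>\<^sup>2)"
    by (rule mult_divide_mult_cancel_left) simp
  finally show ?thesis by (simp add: spline_def del: power_Suc)
qed

lemma spline_continuous [continuous_intros]:
  "continuous_on S g \<Longrightarrow> continuous_on S (\<lambda>x. spline n \<eta> (g x))"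
  unfolding spline_def divide_inverse by (intro continuous_intros)

lemma spline_left: "\<eta> > 0 \<Longrightarrow> n > 0 \<Longrightarrow> x \<le> - \<eta> \<Longrightarrow> spline n \<eta> x = 0"
  by (simp add: spline_def)

lemma spline_right:
  assumes "\<eta> > 0" "x \<ge> \<eta>"
  shows "spline 1 \<eta> x = 0" "spline 2 \<eta> x = 1" "spline 3 \<eta> x = x"
  using assms by (simp_all add: spline_def power2_eq_square power3_eq_cube field_simps fact_numeral)

lemma spline_1_outside: "\<eta> > 0 \<Longrightarrow> \<eta> < \<bar>x\<bar> \<Longrightarrow> spline 1 \<eta> x = 0"
  using spline_left[of \<eta> 1 x] spline_right(1)[of \<eta> x] by (cases "x > 0") auto

lemma spline_1_nonneg: "\<eta> > 0 \<Longrightarrow> spline 1 \<eta> x \<ge> 0"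
  by (auto simp: spline_def max_def)

lemma spline_3_convex: "\<eta> > 0 \<Longrightarrow> convex_on UNIV (spline 3 \<eta>)"
proof (rule f''_ge0_imp_convex)
  assume \<eta>: "\<eta> > 0"
  fix x
  show "DERIV (spline 3 \<eta>) x :> spline 2 \<eta> x" "DERIV (spline 2 \<eta>) x :> spline 1 \<eta> x"
    using spline_deriv[of 2 "\<lambda>x. x" 1 x \<eta>] spline_deriv[of 1 "\<lambda>x. x" 1 x \<eta>]
    by (simp_all add: numeral_3_eq_3 numeral_2_eq_2)
  show "spline 1 \<eta> x \<ge> 0" by (rule spline_1_nonneg[OF \<eta>])
qed simp

lemma compact_support_integrable:
  fixes g :: "real \<Rightarrow> real"
  assumes "continuous_on UNIV g" "\<And>x. \<bar>x\<bar> > r \<Longrightarrow> g x = 0"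
  shows "integrable lborel g" "integrable lebesgue g"
    "(LINT x|lebesgue. g x) = (LINT x|lborel. g x)"
proof -
  have "set_integrable lborel {- r..r} g"
    by (rule borel_integrable_atLeastAtMost') (rule continuous_on_subset[OF assms(1)], simp)
  also have "g x = 0" if "x \<notin> {- r..r}" for x
    by (rule assms(2)) (use that in auto)
  then have "(\<lambda>x. indicator {- r..r} x *\<^sub>R g x) = g"
    by (auto simp: indicator_def fun_eq_iff)
  then have "set_integrable lborel {- r..r} g = integrable lborel g" by (simp add: set_integrable_def)
  finally show i: "integrable lborel g" .
  then have m: "g \<in> borel_measurable lborel" by simp
  show "integrable lebesgue g" using i integrable_completion[OF m] by simp
  show "(LINT x|lebesgue. g x) = (LINT x|lborel. g x)" by (rule integral_completion[OF m])
qed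

lemma integral_deriv_compact_support:
  fixes F f :: "real \<Rightarrow> real"
  assumes r: "r \<ge> 0" and F: "\<And>x. (F has_real_derivative f x) (at x)"
    and cont: "continuous_on UNIV f" and supp: "\<And>x. \<bar>x\<bar> > r \<Longrightarrow> f x = 0"
  shows "(LINT x|lborel. f x) = F r - F (- r)"
proof -
  have "f x = 0" if "x \<notin> {- r..r}" for x
    by (rule supp) (use that in auto)
  then have "(\<lambda>x. f x * indicator {- r..r} x) = f"
    by (auto simp: indicator_def fun_eq_iff)
  moreover have "(\<integral>x. f x * indicator {- r..r} x \<partial>lborel) = F r - F (- r)"
    using r F cont by (intro integral_FTC_Icc_real) (auto simp: continuous_on_eq_continuous_at)
  ultimately show ?thesis by simp
qed

text \<open>Integration by parts twice, in the weak sense for \<open>H\<close> and classically for \<open>x\<^sup>2/2\<close>: the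
  integral equals that of \<open>(H2 - m) \<phi>\<close>.\<close>

lemma weak_second_deriv_test:
  assumes H: "W2_inf H H2" and lower: "AE p in lebesgue. H2 p \<ge> m"
    and \<phi>: "\<And>x. (\<phi> has_real_derivative \<phi>1 x) (at x)" "\<And>x. (\<phi>1 has_real_derivative \<phi>2 x) (at x)"
      "continuous_on UNIV \<phi>2"
    and r: "r \<ge> 0" and supp: "\<And>x. \<bar>x\<bar> > r \<Longrightarrow> \<phi> x = 0 \<and> \<phi>1 x = 0 \<and> \<phi>2 x = 0"
    and nonneg: "\<And>x. \<phi> x \<ge> 0"
  shows "0 \<le> (LINT x|lborel. (H x - m / 2 * x\<^sup>2) * \<phi>2 x)"
proof -
  have cont: "continuous_on UNIV \<phi>" "continuous_on UNIV \<phi>1" "continuous_on UNIV H"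
    using \<phi> H unfolding W2_inf_def by (auto intro!: DERIV_continuous_on)
  obtain H1 where H1: "weak_deriv H H1" "weak_deriv H1 H2" using H unfolding W2_inf_def by blast
  have 1: "(LINT x|lebesgue. H x * \<phi>2 x) = - (LINT x|lebesgue. H1 x * \<phi>1 x)"
    using H1(1) \<phi> supp unfolding weak_deriv_def by blast
  have 2: "(LINT x|lebesgue. H1 x * \<phi>1 x) = - (LINT x|lebesgue. H2 x * \<phi> x)"
    using H1(2) \<phi> supp cont unfolding weak_deriv_def by blast
  have int\<phi>: "integrable lebesgue \<phi>" by (rule compact_support_integrable[OF cont(1), of r]) (use supp in auto)
  have "integrable lebesgue (\<lambda>x. H2 x * \<phi> x)"
  proof -
    obtain M where M: "\<And>x. \<bar>\<phi> x\<bar> \<le> M"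
    proof -
      have "compact (\<phi> ` {- r..r})"
        using cont(1) by (intro compact_continuous_image continuous_on_subset[OF cont(1)]) auto
      then obtain M where "\<forall>x\<in>{- r..r}. \<bar>\<phi> x\<bar> \<le> M"
        using compact_imp_bounded[of "\<phi> ` {- r..r}"] unfolding bounded_iff by auto
      then have "\<bar>\<phi> x\<bar> \<le> \<bar>M\<bar>" for x
      proof (cases "\<bar>x\<bar> > r")
        case False
        then have "x \<in> {- r..r}" by auto
        then have "\<bar>\<phi> x\<bar> \<le> M" using \<open>\<forall>x\<in>{- r..r}. \<bar>\<phi> x\<bar> \<le> M\<close> by blast
        then show ?thesis by linarith
      qed (simp add: supp)
      then show ?thesis using that by blast
    qed
    have "set_integrable lebesgue {- r..r} H2"
      using H1(2) unfolding weak_deriv_def locally_integrable_def by blast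
    then have "integrable lebesgue (\<lambda>x. M * (indicator {- r..r} x *\<^sub>R H2 x))"
      unfolding set_integrable_def by (rule integrable_mult_right)
    then show ?thesis
    proof (rule Bochner_Integration.integrable_bound)
      show "(\<lambda>x. H2 x * \<phi> x) \<in> borel_measurable lebesgue"
        using H int\<phi> unfolding W2_inf_def by (intro borel_measurable_times) auto
      show "AE x in lebesgue. norm (H2 x * \<phi> x) \<le> norm (M * (indicator {- r..r} x *\<^sub>R H2 x))"
      proof (rule AE_I2)
        fix x
        show "norm (H2 x * \<phi> x) \<le> norm (M * (indicator {- r..r} x *\<^sub>R H2 x))"
        proof (cases "\<bar>x\<bar> > r")
          case True then show ?thesis using supp by simp
        next
          case False
          then have "indicator {- r..r} x = (1::real)" by (auto simp: indicator_def abs_le_iff)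
          moreover have "\<bar>\<phi> x\<bar> \<le> \<bar>M\<bar>" using M[of x] by linarith
          ultimately show ?thesis
            using mult_right_mono[of "\<bar>\<phi> x\<bar>" "\<bar>M\<bar>" "\<bar>H2 x\<bar>"] by (simp add: abs_mult mult.commute)
        qed
      qed
    qed
  qed
  moreover have "integrable lebesgue (\<lambda>x. m * \<phi> x)" using int\<phi> by simp
  ultimately have "(LINT x|lebesgue. m * \<phi> x) \<le> (LINT x|lebesgue. H2 x * \<phi> x)"
  proof (intro integral_mono_AE)
    show "AE x in lebesgue. m * \<phi> x \<le> H2 x * \<phi> x"
      using lower by eventually_elim (use nonneg in \<open>auto intro: mult_right_mono\<close>)
  qed
  also have "\<dots> = (LINT x|lebesgue. H x * \<phi>2 x)" using 1 2 by simp
  also have "\<dots> = (LINT x|lborel. H x * \<phi>2 x)"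
    by (rule compact_support_integrable(3)[of _ r]) (use supp \<phi> cont in \<open>auto intro!: continuous_intros\<close>)
  finally have ge: "m * (LINT x|lebesgue. \<phi> x) \<le> (LINT x|lborel. H x * \<phi>2 x)" by simp
  have "(LINT x|lborel. x\<^sup>2 / 2 * \<phi>2 x - \<phi> x) =
      (\<lambda>x. x\<^sup>2 / 2 * \<phi>1 x - x * \<phi> x) (r + 1) - (\<lambda>x. x\<^sup>2 / 2 * \<phi>1 x - x * \<phi> x) (- (r + 1))"
  proof (rule integral_deriv_compact_support)
    show "((\<lambda>x. x\<^sup>2 / 2 * \<phi>1 x - x * \<phi> x) has_real_derivative x\<^sup>2 / 2 * \<phi>2 x - \<phi> x) (at x)" for x
      by (rule derivative_eq_intros \<phi> refl | simp)+
    show "continuous_on UNIV (\<lambda>x. x\<^sup>2 / 2 * \<phi>2 x - \<phi> x)"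
      using \<phi> cont by (intro continuous_intros) auto
  qed (use r supp in auto)
  also have "\<dots> = 0" using r supp[of "r+1"] supp[of "- (r+1)"] by simp
  finally have z: "(LINT x|lborel. x\<^sup>2 / 2 * \<phi>2 x - \<phi> x) = 0" .
  have i: "integrable lborel (\<lambda>x. x\<^sup>2 / 2 * \<phi>2 x)" "integrable lborel \<phi>" "integrable lborel (\<lambda>x. H x * \<phi>2 x)"
    by (rule compact_support_integrable(1)[of _ r]; use supp \<phi> cont in \<open>auto intro!: continuous_intros\<close>)+
  have "(LINT x|lborel. (H x - m / 2 * x\<^sup>2) * \<phi>2 x) =
      (LINT x|lborel. H x * \<phi>2 x - m * (x\<^sup>2 / 2 * \<phi>2 x))"
    by (intro Bochner_Integration.integral_cong refl) (simp add: algebra_simps)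
  also have "\<dots> = (LINT x|lborel. H x * \<phi>2 x) - m * (LINT x|lborel. x\<^sup>2 / 2 * \<phi>2 x)"
    using Bochner_Integration.integral_diff[OF i(3) integrable_mult_right[OF i(1), of m]]
    by (simp only: integral_mult_right_zero)
  also have "(LINT x|lborel. x\<^sup>2 / 2 * \<phi>2 x) = (LINT x|lborel. \<phi> x)"
    using z Bochner_Integration.integral_diff[OF i(1,2)] by simp
  also have "(LINT x|lborel. \<phi> x) = (LINT x|lebesgue. \<phi> x)"
    by (rule compact_support_integrable(3)[of _ r, symmetric]) (use supp cont in auto)
  finally show ?thesis using ge by simp
qed

text \<open>The previous lemma is applied to a smoothing of the hat function over \<open>a, c, b\<close>, that is to
  \<open>\<phi> = (1-t) S(x-a) + t S(x-b) - S(x-c)\<close> with \<open>S = spline 3 \<eta>\<close>: it has compact support since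
  \<open>S(x) = x\<close> for large \<open>x\<close>, and it is nonnegative since \<open>S\<close> is convex. Its second derivative is
  the same combination of tents, so the local average over \<open>s\<close> of the convexity defect of
  \<open>f\<close> at \<open>a+s, b+s, c+s\<close> is nonnegative at every scale, and by continuity the defect itself is.\<close>

lemma W2_inf_strongly_convex:
  assumes H: "W2_inf H H2" and lower: "AE p in lebesgue. H2 p \<ge> m"
  shows "convex_on UNIV (\<lambda>p. H p - m / 2 * p\<^sup>2)"
proof (rule convex_onI)
  fix t a b :: real
  assume t: "0 < t" "t < 1"
  define f where "f p = H p - m / 2 * p\<^sup>2" for p
  define c where "c = (1 - t) * a + t * b"
  have contf: "continuous_on UNIV f"
    unfolding f_def using H by (auto simp: W2_inf_def intro!: continuous_intros)
  define F where "F s = (1 - t) * f (a + s) + t * f (b + s) - f (c + s)" for s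
  have contF: "continuous_on UNIV F"
    unfolding F_def by (intro continuous_intros continuous_on_compose2[OF contf]) auto
  have avg: "0 \<le> (LINT s|lborel. F s * spline 1 \<eta> s)" if \<eta>: "\<eta> > 0" for \<eta>
  proof -
    define \<phi> where "\<phi> n x = (1 - t) * spline n \<eta> (x - a) + t * spline n \<eta> (x - b) - spline n \<eta> (x - c)" for n x
    define r where "r = \<eta> + \<bar>a\<bar> + \<bar>b\<bar> + \<bar>c\<bar>"
    have supp: "\<phi> 1 x = 0 \<and> \<phi> 2 x = 0 \<and> \<phi> 3 x = 0" if "\<bar>x\<bar> > r" for x
    proof (cases "x > 0")
      case True
      then have "\<eta> \<le> x - a" "\<eta> \<le> x - b" "\<eta> \<le> x - c" using that unfolding r_def by auto
      then show ?thesis using \<eta> unfolding \<phi>_def 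
        by (simp add: spline_right c_def algebra_simps del: One_nat_def)
    next
      case False
      then have "x - a \<le> - \<eta>" "x - b \<le> - \<eta>" "x - c \<le> - \<eta>" using that unfolding r_def by auto
      then show ?thesis using \<eta> unfolding \<phi>_def by (simp add: spline_left del: One_nat_def)
    qed
    have ge0: "0 \<le> (LINT x|lborel. (H x - m / 2 * x\<^sup>2) * \<phi> 1 x)"
    proof (rule weak_second_deriv_test[OF H lower])
      show "(\<phi> 3 has_real_derivative \<phi> 2 x) (at x)" for x
        unfolding \<phi>_def numeral_3_eq_3 numeral_2_eq_2
        by (rule derivative_eq_intros refl | simp)+
      show "(\<phi> 2 has_real_derivative \<phi> 1 x) (at x)" for x
        unfolding \<phi>_def numeral_2_eq_2 by (rule derivative_eq_intros refl | simp)+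
      show "continuous_on UNIV (\<phi> 1)" unfolding \<phi>_def by (intro continuous_intros)
      show "r \<ge> 0" using \<eta> unfolding r_def by simp
      show "\<bar>x\<bar> > r \<Longrightarrow> \<phi> 3 x = 0 \<and> \<phi> 2 x = 0 \<and> \<phi> 1 x = 0" for x using supp by blast
      show "\<phi> 3 x \<ge> 0" for x
      proof -
        have "x - c = (1 - t) * (x - a) + t * (x - b)" by (simp add: c_def algebra_simps)
        then show ?thesis
          using convex_onD[OF spline_3_convex[OF \<eta>], of t "x - a" "x - b"] t
          unfolding \<phi>_def by simp
      qed
    qed
    have shift: "(LINT x|lborel. f x * spline 1 \<eta> (x - z)) = (LINT s|lborel. f (z + s) * spline 1 \<eta> s)" for z
      using lborel_integral_real_affine[of 1 "\<lambda>x. f x * spline 1 \<eta> (x - z)" z] by simp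
    note sz = spline_1_outside[OF \<eta>]
    have i: "integrable lborel (\<lambda>x. f x * spline 1 \<eta> (x - z))" for z
    proof (rule compact_support_integrable(1)[where r = "\<eta> + \<bar>z\<bar>"])
      show "continuous_on UNIV (\<lambda>x. f x * spline 1 \<eta> (x - z))" by (intro continuous_intros contf)
      show "f x * spline 1 \<eta> (x - z) = 0" if "\<eta> + \<bar>z\<bar> < \<bar>x\<bar>" for x
        using sz[of "x - z"] that by simp
    qed
    have j: "integrable lborel (\<lambda>s. f (z + s) * spline 1 \<eta> s)" for z
      using lborel_integrable_real_affine[OF i[of z], of 1 z] by simp
    have "(LINT s|lborel. F s * spline 1 \<eta> s) =
        (LINT s|lborel. (1 - t) * (f (a + s) * spline 1 \<eta> s) + t * (f (b + s) * spline 1 \<eta> s)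
           - f (c + s) * spline 1 \<eta> s)"
      unfolding F_def by (simp add: algebra_simps)
    also have "\<dots> = (1 - t) * (LINT s|lborel. f (a + s) * spline 1 \<eta> s)
        + t * (LINT s|lborel. f (b + s) * spline 1 \<eta> s) - (LINT s|lborel. f (c + s) * spline 1 \<eta> s)"
      using j by simp
    also have "\<dots> = (LINT x|lborel. (1 - t) * (f x * spline 1 \<eta> (x - a))
        + t * (f x * spline 1 \<eta> (x - b)) - f x * spline 1 \<eta> (x - c))"
      unfolding shift[symmetric] using i by simp
    also have "\<dots> = (LINT x|lborel. (H x - m / 2 * x\<^sup>2) * \<phi> 1 x)"
      unfolding f_def[symmetric] \<phi>_def
      by (intro Bochner_Integration.integral_cong refl) (simp only: algebra_simps)
    finally show ?thesis using ge0 by simp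
  qed
  have "F 0 \<ge> 0"
  proof (rule ccontr)
    assume "\<not> F 0 \<ge> 0"
    then have "- F 0 / 2 > 0" by simp
    moreover have "isCont F 0" using contF by (simp add: continuous_on_eq_continuous_at)
    ultimately obtain \<delta> where \<delta>: "\<delta> > 0" "\<And>s. \<bar>s\<bar> < \<delta> \<Longrightarrow> \<bar>F s - F 0\<bar> < - F 0 / 2"
      unfolding continuous_at_eps_delta dist_real_def by (metis diff_zero)
    define \<eta> where "\<eta> = \<delta> / 2"
    have \<eta>: "\<eta> > 0" using \<delta> by (simp add: \<eta>_def)
    note sz = spline_1_outside[OF \<eta>]
    have mass: "(LINT s|lborel. spline 1 \<eta> s) = 1"
    proof -
      have "(spline 2 \<eta> has_real_derivative spline 1 \<eta> x) (at x)" for x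
        using spline_deriv[of 1 "\<lambda>x. x" 1 x \<eta>] by (simp add: numeral_2_eq_2)
      then have "(LINT s|lborel. spline 1 \<eta> s) = spline 2 \<eta> \<eta> - spline 2 \<eta> (- \<eta>)"
        using \<eta> sz by (intro integral_deriv_compact_support) (auto intro!: continuous_intros)
      then show ?thesis using \<eta> by (simp add: spline_left spline_right)
    qed
    have "(LINT s|lborel. F s * spline 1 \<eta> s) \<le> (LINT s|lborel. F 0 / 2 * spline 1 \<eta> s)"
    proof (rule integral_mono)
      show "integrable lborel (\<lambda>s. F s * spline 1 \<eta> s)" "integrable lborel (\<lambda>s. F 0 / 2 * spline 1 \<eta> s)"
        by (rule compact_support_integrable(1)[of _ \<eta>]; use sz contF in \<open>auto intro!: continuous_intros\<close>)+
      show "F s * spline 1 \<eta> s \<le> F 0 / 2 * spline 1 \<eta> s" for s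
      proof (cases "\<eta> < \<bar>s\<bar>")
        case False
        then have "\<bar>F s - F 0\<bar> < - F 0 / 2" using \<delta> by (auto simp: \<eta>_def)
        then have "F s \<le> F 0 / 2" by (simp add: abs_if split: if_splits)
        then show ?thesis using spline_1_nonneg[OF \<eta>] by (rule mult_right_mono)
      qed (simp add: sz del: One_nat_def)
    qed
    also have "\<dots> = F 0 / 2" using mass by simp
    finally show False using avg[OF \<eta>] \<open>\<not> F 0 \<ge> 0\<close> by simp
  qed
  then show "H ((1 - t) *\<^sub>R a + t *\<^sub>R b) - m / 2 * ((1 - t) *\<^sub>R a + t *\<^sub>R b)\<^sup>2
      \<le> (1 - t) * (H a - m / 2 * a\<^sup>2) + t * (H b - m / 2 * b\<^sup>2)"
    unfolding F_def f_def c_def by simp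
qed simp

section \<open>The Legendre transform and the Hopf-Lax formula\<close>

lemma convex_on_real_subgradient:
  fixes f :: "real \<Rightarrow> real"
  assumes "convex_on UNIV f"
  obtains g where "\<And>y. f x + g * (y - x) \<le> f y"
proof -
  have "\<forall>y. f x + Inf ((\<lambda>t. (f x - f t) / (x - t)) ` ({x<..} \<inter> UNIV)) * (y - x) \<le> f y"
    using convex_le_Inf_differential[OF assms, of x] by auto
  then show thesis using that by blast
qed

text \<open>Strong convexity is required in the form that survives without differentiability of \<open>H\<close>.\<close>

locale strongly_convex_hamiltonian =
  fixes H :: "real \<Rightarrow> real" and m :: real
  assumes m_pos: "m > 0" and H_strongly_convex: "convex_on UNIV (\<lambda>p. H p - m / 2 * p\<^sup>2)"
begin

abbreviation G :: "real \<Rightarrow> real" where "G \<equiv> legendre H"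

lemma strong_subgradient:
  obtains g where "\<And>q. H p + g * (q - p) + m / 2 * (q - p)\<^sup>2 \<le> H q"
proof -
  obtain g where g: "\<And>q. H p - m / 2 * p\<^sup>2 + g * (q - p) \<le> H q - m / 2 * q\<^sup>2"
    using convex_on_real_subgradient[OF H_strongly_convex] by metis
  have "H p + (g + m * p) * (q - p) + m / 2 * (q - p)\<^sup>2 \<le> H q" for q
    using g[of q] by (simp add: power2_eq_square field_simps)
  then show thesis using that by blast
qed

lemma young_bdd: "bdd_above (range (\<lambda>p. a * p - H p))"
proof -
  obtain g where g: "\<And>q. H 0 + g * (q - 0) + m / 2 * (q - 0)\<^sup>2 \<le> H q"
    using strong_subgradient[of 0] by blast
  have "a * p - H p \<le> (a - g)\<^sup>2 / (2 * m) - H 0" for p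
  proof -
    have "0 \<le> (m * p - (a - g))\<^sup>2 / (2 * m)" using m_pos by simp
    also have "\<dots> = m / 2 * p\<^sup>2 - (a - g) * p + (a - g)\<^sup>2 / (2 * m)"
      using m_pos by (simp add: power2_eq_square field_simps)
    finally show ?thesis using g[of p] by (simp add: algebra_simps)
  qed
  then show ?thesis by (intro bdd_aboveI2)
qed

lemma young: "a * p - H p \<le> G a"
  unfolding legendre_def by (rule cSUP_upper[OF _ young_bdd]) simp

lemma legendre_le: "(\<And>p. a * p - H p \<le> B) \<Longrightarrow> G a \<le> B"
  unfolding legendre_def by (rule cSUP_least) auto

lemma legendre_convex: "convex_on UNIV G"
proof (rule convex_onI)
  fix t a b :: real assume t: "0 < t" "t < 1"
  show "G ((1 - t) *\<^sub>R a + t *\<^sub>R b) \<le> (1 - t) * G a + t * G b"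
  proof (rule legendre_le)
    fix p
    have "(1 - t) * (a * p - H p) + t * (b * p - H p) \<le> (1 - t) * G a + t * G b"
      using t young by (intro add_mono mult_left_mono) auto
    then show "((1 - t) *\<^sub>R a + t *\<^sub>R b) * p - H p \<le> (1 - t) * G a + t * G b"
      by (simp add: algebra_simps)
  qed
qed simp

text \<open>Strong convexity of \<open>H\<close> dualizes to a quadratic upper bound on the convexity defect of
  \<open>G\<close>: in Young's inequality at the averaged momentum the gain \<open>m (p - q)\<^sup>2 / 2\<close> absorbs the cross
  term \<open>(a - b)(p - q)\<close>. This is the source of all one-sided second difference bounds below.\<close>

lemma legendre_semiconcave:
  assumes t: "0 \<le> t" "t \<le> 1"
  shows "(1 - t) * G a + t * G b \<le> G ((1 - t) * a + t * b) + t * (1 - t) * (a - b)\<^sup>2 / (2 * m)"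
proof -
  define c where "c = (1 - t) * a + t * b"
  define R where "R = G c + t * (1 - t) * (a - b)\<^sup>2 / (2 * m)"
  have *: "(1 - t) * (a * p - H p) + t * (b * q - H q) \<le> R" for p q
  proof -
    define r where "r = (1 - t) * p + t * q"
    have "H r - m / 2 * r\<^sup>2 \<le> (1 - t) * (H p - m / 2 * p\<^sup>2) + t * (H q - m / 2 * q\<^sup>2)"
      using convex_onD[OF H_strongly_convex t, of p q] unfolding r_def by simp
    then have "H r \<le> (1 - t) * H p + t * H q - m / 2 * (t * (1 - t) * (p - q)\<^sup>2)"
      unfolding r_def by (simp add: power2_eq_square field_simps)
    moreover have "(1 - t) * (a * p) + t * (b * q) = c * r + t * (1 - t) * ((a - b) * (p - q))"
      unfolding r_def c_def by (simp add: algebra_simps)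
    moreover have "t * (1 - t) * ((a - b) * (p - q) - m / 2 * (p - q)\<^sup>2)
        \<le> t * (1 - t) * ((a - b)\<^sup>2 / (2 * m))"
    proof (rule mult_left_mono)
      have "0 \<le> (m * (p - q) - (a - b))\<^sup>2 / (2 * m)" using m_pos by simp
      also have "\<dots> = m / 2 * (p - q)\<^sup>2 - (a - b) * (p - q) + (a - b)\<^sup>2 / (2 * m)"
        using m_pos by (simp add: power2_eq_square field_simps)
      finally show "(a - b) * (p - q) - m / 2 * (p - q)\<^sup>2 \<le> (a - b)\<^sup>2 / (2 * m)" by simp
    qed (use t in simp)
    moreover have "(1 - t) * (a * p - H p) + t * (b * q - H q)
        = ((1 - t) * (a * p) + t * (b * q)) - ((1 - t) * H p + t * H q)" by (simp add: algebra_simps)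
    moreover have "t * (1 - t) * ((a - b) * (p - q) - m / 2 * (p - q)\<^sup>2)
        = t * (1 - t) * ((a - b) * (p - q)) - m / 2 * (t * (1 - t) * (p - q)\<^sup>2)"
      by (simp add: field_simps)
    moreover have "t * (1 - t) * ((a - b)\<^sup>2 / (2 * m)) = t * (1 - t) * (a - b)\<^sup>2 / (2 * m)" by simp
    ultimately show ?thesis using young[of c r] unfolding R_def by linarith
  qed
  show ?thesis
  proof (cases "t = 0 \<or> t = 1")
    case False
    then have t': "0 < t" "t < 1" using t by auto
    have "b * q - H q \<le> (R - (1 - t) * G a) / t" for q
    proof -
      have "G a \<le> (R - t * (b * q - H q)) / (1 - t)"
      proof (rule legendre_le)
        fix p
        have "(a * p - H p) * (1 - t) \<le> R - t * (b * q - H q)"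
          using *[of p q] by (simp add: algebra_simps)
        then show "a * p - H p \<le> (R - t * (b * q - H q)) / (1 - t)"
          using t' by (subst pos_le_divide_eq) auto
      qed
      then have "G a * (1 - t) \<le> R - t * (b * q - H q)" using t' by (subst (asm) pos_le_divide_eq) auto
      then have "(b * q - H q) * t \<le> R - (1 - t) * G a" by (simp add: algebra_simps)
      then show ?thesis using t' by (subst pos_le_divide_eq) auto
    qed
    then have "G b \<le> (R - (1 - t) * G a) / t" by (rule legendre_le)
    then have "G b * t \<le> R - (1 - t) * G a" using t' by (subst (asm) pos_le_divide_eq) auto
    then show ?thesis unfolding R_def c_def by (simp add: mult.commute)
  qed auto
qed

text \<open>Young's inequality at the two momenta \<open>c\<close> and \<open>-c\<close>.\<close>

lemma legendre_superlinear: "c * \<bar>a\<bar> - max (H c) (H (- c)) \<le> G a"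
  using young[of a c] young[of a "- c"] by (cases "a \<ge> 0") (auto simp: algebra_simps)

text \<open>Fenchel duality: a subgradient of \<open>H\<close> at \<open>p\<close> attains \<open>H p = max (a p - G a)\<close>.\<close>

lemma biconjugate:
  obtains a where "H p = a * p - G a" "\<And>q. H p + a * (q - p) \<le> H q"
proof -
  obtain g where g: "\<And>q. H p + g * (q - p) + m / 2 * (q - p)\<^sup>2 \<le> H q"
    using strong_subgradient[of p] by blast
  have g': "H p + g * (q - p) \<le> H q" for q
  proof -
    have "0 \<le> m / 2 * (q - p)\<^sup>2" using m_pos by simp
    then show ?thesis using g[of q] by linarith
  qed
  have "G g \<le> g * p - H p"
  proof (rule legendre_le)
    show "g * q - H q \<le> g * p - H p" for q using g'[of q] by (simp add: algebra_simps)
  qed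
  then have "H p = g * p - G g" using young[of g p] by simp
  then show thesis using that g' by blast
qed

lemma hamiltonian_continuous: "continuous_on UNIV H"
proof -
  have "continuous_on UNIV (\<lambda>p. H p - m / 2 * p\<^sup>2 + m / 2 * p\<^sup>2)"
    by (intro continuous_intros convex_on_continuous H_strongly_convex) simp
  then show ?thesis by simp
qed

lemma biconjugate_bounded:
  obtains K where "\<And>p. \<bar>p\<bar> \<le> L \<Longrightarrow> \<exists>a. \<bar>a\<bar> \<le> K \<and> H p = a * p - G a"
proof -
  have "compact (H ` {- (\<bar>L\<bar> + 1)..\<bar>L\<bar> + 1})"
    by (intro compact_continuous_image continuous_on_subset[OF hamiltonian_continuous]) auto
  then obtain M where M: "\<forall>q\<in>{- (\<bar>L\<bar> + 1)..\<bar>L\<bar> + 1}. \<bar>H q\<bar> \<le> M"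
    using compact_imp_bounded[of "H ` {- (\<bar>L\<bar> + 1)..\<bar>L\<bar> + 1}"] unfolding bounded_iff by auto
  have "\<exists>a. \<bar>a\<bar> \<le> 2 * M \<and> H p = a * p - G a" if "\<bar>p\<bar> \<le> L" for p
  proof -
    obtain a where a: "H p = a * p - G a" "\<And>q. H p + a * (q - p) \<le> H q" using biconjugate by blast
    have "p \<in> {- (\<bar>L\<bar> + 1)..\<bar>L\<bar> + 1}" "p + 1 \<in> {- (\<bar>L\<bar> + 1)..\<bar>L\<bar> + 1}" "p - 1 \<in> {- (\<bar>L\<bar> + 1)..\<bar>L\<bar> + 1}"
      using that by auto
    then have "\<bar>H p\<bar> \<le> M" "\<bar>H (p + 1)\<bar> \<le> M" "\<bar>H (p - 1)\<bar> \<le> M" using M by blast+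
    then have "\<bar>a\<bar> \<le> 2 * M" using a(2)[of "p + 1"] a(2)[of "p - 1"] by simp
    then show ?thesis using a by blast
  qed
  then show thesis using that by blast
qed

end

locale hopf_lax = strongly_convex_hamiltonian +
  fixes v0 :: "real \<Rightarrow> real" and L :: real
  assumes v0_lipschitz: "L-lipschitz_on UNIV v0"
begin

lemma L_nonneg: "L \<ge> 0" using v0_lipschitz lipschitz_on_nonneg by blast

lemma v0_diff: "\<bar>v0 x - v0 y\<bar> \<le> L * \<bar>x - y\<bar>"
  using lipschitz_onD[OF v0_lipschitz, of x y] by (simp add: dist_real_def)

definition \<kappa> :: real where "\<kappa> = max (H L) (H (- L))"

lemma kappa: "L * \<bar>a\<bar> - \<kappa> \<le> G a" unfolding \<kappa>_def by (rule legendre_superlinear)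

text \<open>The Hopf-Lax function, parametrized by the velocity \<open>a\<close> of the straight characteristic
  through \<open>(t, x)\<close> instead of its foot point; this form is also correct for \<open>t = 0\<close>.\<close>

definition W :: "real \<Rightarrow> real \<Rightarrow> real" where
  "W t x = (INF a. v0 (x - a * t) + t * G a)"

lemma W_lower:
  assumes "t \<ge> 0" shows "v0 x - t * \<kappa> \<le> v0 (x - a * t) + t * G a"
proof -
  have "v0 x \<le> v0 (x - a * t) + L * (\<bar>a\<bar> * t)"
    using v0_diff[of x "x - a * t"] assms by (simp add: abs_mult)
  moreover have "t * (L * \<bar>a\<bar> - \<kappa>) \<le> t * G a" by (rule mult_left_mono[OF kappa assms])
  ultimately show ?thesis by (simp add: algebra_simps)
qed

lemma W_bdd: "t \<ge> 0 \<Longrightarrow> bdd_below (range (\<lambda>a. v0 (x - a * t) + t * G a))"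
  using W_lower by (intro bdd_belowI2)

lemma W_le: "t \<ge> 0 \<Longrightarrow> W t x \<le> v0 (x - a * t) + t * G a"
  unfolding W_def by (rule cINF_lower[OF W_bdd]) auto

lemma W_ge: "(\<And>a. B \<le> v0 (x - a * t) + t * G a) \<Longrightarrow> B \<le> W t x"
  unfolding W_def by (rule cINF_greatest) auto

lemma W_approx:
  assumes "t \<ge> 0" "\<rho> > 0" obtains a where "v0 (x - a * t) + t * G a < W t x + \<rho>"
proof -
  have "\<exists>a\<in>UNIV. v0 (x - a * t) + t * G a < W t x + \<rho>"
    unfolding W_def using assms
    by (subst cINF_less_iff[symmetric]) (auto simp: W_bdd)
  then show thesis using that by blast
qed

lemma W_0: "W 0 x = v0 x" by (simp add: W_def)

text \<open>The semigroup property is split into two inequalities. Convexity of \<open>G\<close> makes a broken path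
  at least as expensive as the straight one with the same end points, which gives \<open>W_dpp_le\<close>; a
  nearly optimal straight path, cut at time \<open>t\<close>, gives \<open>W_dpp_approx\<close>.\<close>

lemma W_dpp_le:
  assumes "t \<ge> 0" "k \<ge> 0"
  shows "W (t + k) x \<le> W t (x - k * a) + k * G a"
proof (cases "t + k = 0")
  case True
  then have "t = 0" "k = 0" using assms by auto
  then show ?thesis by simp
next
  case False
  then have pos: "t + k > 0" using assms by simp
  have "W (t + k) x - k * G a \<le> W t (x - k * a)"
  proof (rule W_ge)
    fix b
    define s where "s = k / (t + k)"
    have s: "0 \<le> s" "s \<le> 1" "s * (t + k) = k" "(1 - s) * (t + k) = t"
      using assms pos by (auto simp: s_def field_simps)
    define c where "c = (1 - s) * b + s * a"
    have "c * (t + k) = b * t + k * a"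
    proof -
      have "c * (t + k) = b * ((1 - s) * (t + k)) + a * (s * (t + k))"
        unfolding c_def by (simp add: algebra_simps)
      then show ?thesis using s(3,4) by (simp add: mult.commute)
    qed
    then have "W (t + k) x \<le> v0 (x - k * a - b * t) + (t + k) * G c"
      using W_le[of "t + k" x c] assms by (simp add: algebra_simps)
    also have "G c \<le> (1 - s) * G b + s * G a"
      using convex_onD[OF legendre_convex, of s b a] s unfolding c_def by simp
    then have "(t + k) * G c \<le> (t + k) * ((1 - s) * G b + s * G a)"
      by (rule mult_left_mono) (use assms in simp)
    also have "\<dots> = t * G b + k * G a"
    proof -
      have "(t + k) * ((1 - s) * G b + s * G a) = ((1 - s) * (t + k)) * G b + (s * (t + k)) * G a"
        by (simp add: algebra_simps)
      then show ?thesis using s(3,4) by simp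
    qed
    finally show "W (t + k) x - k * G a \<le> v0 (x - k * a - b * t) + t * G b" by simp
  qed
  then show ?thesis by simp
qed

lemma W_dpp_approx:
  assumes "t \<ge> 0" "k \<ge> 0" "\<rho> > 0"
  obtains a where "W t (x - k * a) + k * G a < W (t + k) x + \<rho>"
proof -
  obtain a where "v0 (x - a * (t + k)) + (t + k) * G a < W (t + k) x + \<rho>"
    using W_approx[of "t + k" \<rho> x] assms by auto
  moreover have "W t (x - k * a) \<le> v0 (x - k * a - a * t) + t * G a" by (rule W_le[OF assms(1)])
  ultimately show thesis using that[of a] by (simp add: algebra_simps)
qed

lemma W_lipschitz_x: "t \<ge> 0 \<Longrightarrow> L-lipschitz_on UNIV (W t)"
proof (rule lipschitz_onI)
  assume t: "t \<ge> 0"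
  have *: "W t x \<le> W t y + L * \<bar>x - y\<bar>" for x y
  proof -
    have "W t x - L * \<bar>x - y\<bar> \<le> W t y"
    proof (rule W_ge)
      fix a
      show "W t x - L * \<bar>x - y\<bar> \<le> v0 (y - a * t) + t * G a"
        using W_le[OF t, of x a] v0_diff[of "x - a * t" "y - a * t"] by simp
    qed
    then show ?thesis by simp
  qed
  fix x y
  show "dist (W t x) (W t y) \<le> L * dist x y"
    using *[of x y] *[of y x] by (simp add: dist_real_def abs_le_iff abs_minus_commute)
qed (rule L_nonneg)

lemma W_diff_x: "t \<ge> 0 \<Longrightarrow> \<bar>W t x - W t y\<bar> \<le> L * \<bar>x - y\<bar>"
  using lipschitz_onD[OF W_lipschitz_x, of t x y] by (simp add: dist_real_def)

lemma W_diff_t: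
  assumes "t \<ge> 0" "s \<ge> 0" shows "\<bar>W t x - W s x\<bar> \<le> (\<bar>G 0\<bar> + \<bar>\<kappa>\<bar>) * \<bar>t - s\<bar>"
proof -
  have *: "\<bar>W (s + k) x - W s x\<bar> \<le> (\<bar>G 0\<bar> + \<bar>\<kappa>\<bar>) * k" if sk: "s \<ge> 0" "k \<ge> 0" for s k
  proof -
    have "W (s + k) x \<le> W s x + k * G 0" using W_dpp_le[OF that, of x 0] by simp
    moreover have "W s x - k * \<kappa> \<le> W (s + k) x"
    proof (rule field_le_epsilon)
      fix \<rho> :: real assume "\<rho> > 0"
      then obtain a where a: "W s (x - k * a) + k * G a < W (s + k) x + \<rho>"
        using W_dpp_approx[OF sk] by blast
      have "W s x \<le> W s (x - k * a) + L * (k * \<bar>a\<bar>)"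
        using W_diff_x[OF that(1), of x "x - k * a"] that by (simp add: abs_mult)
      moreover have "k * (L * \<bar>a\<bar> - \<kappa>) \<le> k * G a" by (rule mult_left_mono[OF kappa that(2)])
      ultimately show "W s x - k * \<kappa> \<le> W (s + k) x + \<rho>" using a by (simp add: algebra_simps)
    qed
    moreover have "k * G 0 \<le> k * (\<bar>G 0\<bar> + \<bar>\<kappa>\<bar>)" "k * \<kappa> \<le> k * (\<bar>G 0\<bar> + \<bar>\<kappa>\<bar>)"
      using that by (intro mult_left_mono; simp)+
    ultimately show ?thesis by (simp add: abs_le_iff algebra_simps)
  qed
  show ?thesis
  proof (cases "s \<le> t")
    case True then show ?thesis using *[of s "t - s"] assms by simp
  next
    case False then show ?thesis using *[of t "s - t"] assms by (simp add: abs_minus_commute)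
  qed
qed

end

section \<open>One-step and accumulated error of the scheme\<close>

text \<open>One step of the scheme, for an arbitrary reconstruction \<open>R\<close> of the previous data.\<close>

definition sl_step ::
  "(real \<Rightarrow> real) \<Rightarrow> (real \<Rightarrow> real) \<Rightarrow> real set \<Rightarrow> real list \<Rightarrow> real \<Rightarrow> real \<Rightarrow> real" where
  "sl_step G R A b k x = (INF a\<in>{a. length a = length b \<and> set a \<subseteq> A}.
     R (x - k * (\<Sum>i<length b. b ! i * a ! i)) + k * (\<Sum>i<length b. b ! i * G (a ! i)))"

lemma rk_weights_sum: "b \<in> rk_weights \<Longrightarrow> (\<Sum>i<length b. b ! i) = 1"
  by (auto simp: rk_weights_def numeral_3_eq_3 numeral_2_eq_2 lessThan_Suc)

lemma rk_weights_nonneg: "b \<in> rk_weights \<Longrightarrow> i < length b \<Longrightarrow> b ! i \<ge> 0"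
  by (auto simp: rk_weights_def less_Suc_eq numeral_3_eq_3 numeral_2_eq_2)

lemma rk_weights_jensen:
  assumes b: "b \<in> rk_weights" and G: "convex_on UNIV G"
  shows "G (\<Sum>i<length b. b ! i * a ! i) \<le> (\<Sum>i<length b. b ! i * G (a ! i))"
proof -
  have "length b > 0" using b by (auto simp: rk_weights_def)
  then show ?thesis
    using convex_on_sum[of "{..<length b}" UNIV G "\<lambda>i. b ! i" "\<lambda>i. a ! i"]
      G rk_weights_sum[OF b] rk_weights_nonneg[OF b] by auto
qed

text \<open>By Jensen's inequality a tuple of controls costs at least as much as the constant tuple of its
  average, and both have the same foot point. So a step behaves like a minimization over single
  controls: upper bounds hold for the controls in \<open>A\<close>, lower bounds and near-minimizers refer to
  averages, which may leave \<open>A\<close>. A lower bound of the functional makes the infimum meaningful.\<close>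

lemma
  assumes b: "b \<in> rk_weights" and G: "convex_on UNIV G" and k: "k \<ge> 0"
    and bdd: "\<And>a. B \<le> R (x - k * a) + k * G a"
  shows sl_step_le: "c \<in> A \<Longrightarrow> sl_step G R A b k x \<le> R (x - k * c) + k * G c"
    and sl_step_ge: "c \<in> A \<Longrightarrow> B \<le> sl_step G R A b k x"
    and sl_step_approx: "c \<in> A \<Longrightarrow> \<rho> > 0 \<Longrightarrow> \<exists>a. R (x - k * a) + k * G a < sl_step G R A b k x + \<rho>"
proof -
  define val where "val a = R (x - k * (\<Sum>i<length b. b ! i * a ! i)) + k * (\<Sum>i<length b. b ! i * G (a ! i))" for a
  define S where "S = {a. length a = length b \<and> set a \<subseteq> A}"
  have jen: "R (x - k * (\<Sum>i<length b. b ! i * a ! i)) + k * G (\<Sum>i<length b. b ! i * a ! i) \<le> val a" for a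
    unfolding val_def using rk_weights_jensen[OF b G, of a] k by (simp add: mult_left_mono)
  then have B: "B \<le> val a" for a using bdd order_trans by blast
  then have bb: "bdd_below (val ` S)" by (intro bdd_belowI2)
  have st: "sl_step G R A b k x = Inf (val ` S)"
    unfolding sl_step_def val_def S_def ..
  assume c: "c \<in> A"
  have rS: "replicate (length b) c \<in> S" using c by (auto simp: S_def)
  then have ne: "S \<noteq> {}" by blast
  have "val (replicate (length b) c) = R (x - k * c) + k * G c"
    unfolding val_def using rk_weights_sum[OF b] by (simp add: sum_distrib_right[symmetric])
  then show "sl_step G R A b k x \<le> R (x - k * c) + k * G c"
    unfolding st using cINF_lower[OF bb rS] by simp
  show "B \<le> sl_step G R A b k x" unfolding st by (rule cINF_greatest[OF ne B])
  assume "\<rho> > 0"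
  then have "\<exists>a\<in>S. val a < Inf (val ` S) + \<rho>"
    by (subst cINF_less_iff[OF ne bb, symmetric]) simp
  then show "\<exists>a. R (x - k * a) + k * G a < sl_step G R A b k x + \<rho>"
    unfolding st using jen le_less_trans by blast
qed

lemma sl_scheme_Suc:
  "sl_scheme kind d l \<epsilon> H v0 A b dx dt (Suc n) j =
     sl_step (legendre H) (recon kind d l \<epsilon> dx (sl_scheme kind d l \<epsilon> H v0 A b dx dt n)) A b dt (node dx j)"
  by (simp add: sl_step_def)

context hopf_lax
begin

lemma control_bound:
  assumes "G a - L * \<bar>a\<bar> \<le> B"
  shows "\<bar>a\<bar> \<le> B + max (H (L + 1)) (H (- (L + 1)))"
  using legendre_superlinear[of "L + 1" a] assms by (simp add: algebra_simps)

text \<open>One step applied to data close to \<open>W\<close>. Lower bound: \<open>recon_ge_node\<close> turns the reconstruction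
  into a nodal value, and \<open>W_dpp_le\<close> applies. Upper bound: controls that hit a node are used,
  since the reconstruction is exact there; among the two nodes next to the foot point of a nearly
  optimal control one costs at most \<open>O(h)\<close> more, by \<open>legendre_semiconcave\<close>. Second differences: the
  neighbours \<open>x\<^sub>j \<plusminus> h\<close> may use the foot point that is nearly optimal for \<open>x\<^sub>j\<close>, so only the second
  difference of \<open>k G\<close> at distance \<open>h/k\<close> counts, at most \<open>h\<^sup>2/(m k) \<le> h\<close>. For the last two points the
  controls must lie in \<open>[-K, K]\<close>; superlinearity of \<open>G\<close> bounds nearly optimal ones by
  \<open>K - 1\<close>, provided that the accumulated error \<open>E\<close> is \<open>O(k)\<close>, and the changes made to them are at most
  \<open>h/k \<le> 1\<close>.\<close>

lemma scheme_step:
  assumes h: "0 < h" "h \<le> k" "h \<le> m * k" and eps: "\<epsilon> > 0" and d: "0 < d" "d < 7/18"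
    and t: "t \<ge> 0" and b: "b \<in> rk_weights" and A: "{- K..K} \<subseteq> A"
    and K: "\<bar>G 0\<bar> + \<bar>max (H (L + 1)) (H (- (L + 1)))\<bar> + B + 2 \<le> K"
    and EB: "2 * E + (6 * L + 2) * h \<le> B * k"
    and U: "\<And>j. \<bar>U j - W t (node h j)\<bar> \<le> E"
    and semi: "\<And>j. U (j + 1) - 2 * U j + U (j - 1) \<le> (2 * L + 1) * h"
    and V: "\<And>j. V j = sl_step G (recon kind d l \<epsilon> h U) A b k (node h j)"
  shows "\<bar>V j - W (t + k) (node h j)\<bar> \<le> E + (6 * L + 2) * h"
    and "V (j + 1) - 2 * V j + V (j - 1) \<le> (2 * L + 1) * h"
proof -
  define R where "R = recon kind d l \<epsilon> h U"
  define C where "C = 6 * L + 2"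
  define kap where "kap = max (H (L + 1)) (H (- (L + 1)))"
  note L = L_nonneg
  have k: "k > 0" using h by simp
  have E: "E \<ge> 0" using U[of 0] by linarith
  have Bpos: "B \<ge> 0"
  proof -
    have "0 \<le> 2 * E + (6 * L + 2) * h" using E L h by simp
    then have "0 \<le> B * k" using EB by linarith
    then show ?thesis using k by (simp add: zero_le_mult_iff)
  qed
  note R_node = recon_node[OF h(1) eps d, of kind l U, folded R_def]
  have R_ge: "W t y - E - C * h \<le> R y" for y
  proof -
    obtain i where i: "\<bar>node h i - y\<bar> \<le> 2 * h" "U i - 2 * ((2 * L + 1) * h) \<le> R y"
      using recon_ge_node[OF h(1) eps d semi, of y kind l] L h unfolding R_def by auto
    have "L * \<bar>node h i - y\<bar> \<le> L * (2 * h)" by (rule mult_left_mono[OF i(1) L])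
    then show ?thesis
      using W_diff_x[OF t, of "node h i" y] U[of i] i(2) unfolding C_def
      by (simp add: algebra_simps)
  qed
  have val_ge: "W (t + k) x - E - C * h \<le> R (x - k * a) + k * G a" for x a
    using R_ge[of "x - k * a"] W_dpp_le[OF t, of k x a] k by simp
  note bdd = val_ge[of "node h j" for j]
  have inA: "c \<in> A" if "\<bar>c\<bar> \<le> K" for c using A that by (auto simp: abs_le_iff subset_iff)
  have K0: "0 \<in> A" using K Bpos by (intro inA) simp
  have V_le: "V j \<le> R (node h j - k * c) + k * G c" if "\<bar>c\<bar> \<le> K" for j c
    unfolding V R_def[symmetric]
    using sl_step_le[OF b legendre_convex less_imp_le[OF k] bdd inA[OF that]] .
  have lower: "W (t + k) (node h j) - E - C * h \<le> V j" for j
    unfolding V R_def[symmetric]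
    using sl_step_ge[OF b legendre_convex less_imp_le[OF k] bdd K0] .
  have upper: "V j \<le> W (t + k) (node h j) + E + C * h" for j
  proof (rule field_le_epsilon)
    fix \<rho>' :: real assume "\<rho>' > 0"
    define \<rho> where "\<rho> = min \<rho>' k"
    have \<rho>: "\<rho> > 0" "\<rho> \<le> k" "\<rho> \<le> \<rho>'" using \<open>\<rho>' > 0\<close> k by (auto simp: \<rho>_def)
    define x where "x = node h j"
    obtain a where a: "W t (x - k * a) + k * G a < W (t + k) x + \<rho>"
      using W_dpp_approx[OF t less_imp_le[OF k] \<rho>(1)] by blast
    have "W t x \<le> W t (x - k * a) + L * (k * \<bar>a\<bar>)"
      using W_diff_x[OF t, of x "x - k * a"] k by (simp add: abs_mult)
    moreover have "W (t + k) x \<le> W t x + k * G 0" using W_dpp_le[OF t, of k x 0] k by simp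
    ultimately have "k * (G a - L * \<bar>a\<bar>) \<le> k * (G 0 + 1)"
      using a \<rho> by (simp add: algebra_simps)
    then have "\<bar>a\<bar> \<le> G 0 + 1 + kap" using k unfolding kap_def by (intro control_bound) simp
    then have aK: "\<bar>a\<bar> \<le> K - 1" using K Bpos unfolding kap_def by linarith
    \<comment> \<open>The foot point lies in cell \<open>i\<close>; the control \<open>c i'\<close> leads exactly to node \<open>i'\<close>.\<close>
    define y where "y = x - k * a"
    define i where "i = \<lfloor>y / h\<rfloor>"
    define \<theta> where "\<theta> = y / h - of_int i"
    have y: "y \<in> {node h i..node h (i+1)}" unfolding i_def by (rule floor_cell[OF h(1)])
    have \<theta>: "0 \<le> \<theta>" "\<theta> \<le> 1" "\<theta> * (1 - \<theta>) \<le> 1/4"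
      using cell_bounds(1-3)[OF h(1) y \<theta>_def refl] by auto
    define c where "c i' = (x - node h i') / k" for i'
    have xc: "x - k * c i' = node h i'" for i' using k by (simp add: c_def)
    have near: "V j \<le> W t y + L * h + E + k * G (c i')" if "i' \<in> {i, i+1}" for i'
    proof -
      have d: "\<bar>node h i' - y\<bar> \<le> h"
        using that y h by (auto simp: node_def algebra_simps abs_le_iff)
      have "c i' - a = (y - node h i') / k" using k by (simp add: c_def y_def field_simps)
      then have "\<bar>c i' - a\<bar> = \<bar>node h i' - y\<bar> / k" using k by (simp add: abs_minus_commute)
      also have "\<dots> \<le> 1" using d h k by simp
      finally have "\<bar>c i'\<bar> \<le> K" using aK by linarith
      from V_le[OF this, of j] have "V j \<le> U i' + k * G (c i')"
        unfolding x_def[symmetric] xc R_node .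
      moreover have "L * \<bar>node h i' - y\<bar> \<le> L * h" by (rule mult_left_mono[OF d L])
      ultimately show ?thesis using U[of i'] W_diff_x[OF t, of "node h i'" y] by linarith
    qed
    have mid: "(1 - \<theta>) * c i + \<theta> * c (i + 1) = a"
    proof -
      have "y = (1 - \<theta>) * node h i + \<theta> * node h (i + 1)"
        unfolding \<theta>_def using h(1) by (simp add: node_def algebra_simps)
      moreover have "(1 - \<theta>) * c i + \<theta> * c (i + 1)
          = (x - ((1 - \<theta>) * node h i + \<theta> * node h (i + 1))) / k"
        by (simp add: c_def diff_divide_distrib add_divide_distrib algebra_simps)
      ultimately have "(1 - \<theta>) * c i + \<theta> * c (i + 1) = (x - y) / k" by (simp only:)
      then show ?thesis using k by (simp add: y_def)
    qed
    have diff: "c i - c (i + 1) = h / k" using k by (simp add: c_def node_def field_simps)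
    have "k * ((1 - \<theta>) * G (c i) + \<theta> * G (c (i + 1))) \<le> k * (G a + \<theta> * (1 - \<theta>) * (h / k)\<^sup>2 / (2 * m))"
      using legendre_semiconcave[OF \<theta>(1,2), of "c i" "c (i + 1)"] k unfolding mid diff
      by (intro mult_left_mono) auto
    also have "\<dots> = k * G a + \<theta> * (1 - \<theta>) * (h / (2 * (m * k)) * h)"
      using k m_pos by (simp add: field_simps power2_eq_square)
    also have "\<theta> * (1 - \<theta>) * (h / (2 * (m * k)) * h) \<le> 1 * (1 * h)"
      using \<theta> h k m_pos by (intro mult_mono mult_nonneg_nonneg) auto
    finally have G: "(1 - \<theta>) * (k * G (c i)) + \<theta> * (k * G (c (i + 1))) \<le> k * G a + h"
      by (simp add: algebra_simps)
    have "(1 - \<theta>) * V j + \<theta> * V j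
        \<le> (1 - \<theta>) * (W t y + L * h + E + k * G (c i)) + \<theta> * (W t y + L * h + E + k * G (c (i + 1)))"
      using \<theta> near by (intro add_mono mult_left_mono) auto
    then have "V j \<le> W t y + L * h + E + (k * G a + h)"
      using G by (simp add: algebra_simps)
    also have "\<dots> \<le> W (t + k) x + \<rho> + E + (L + 1) * h" using a unfolding y_def by (simp add: algebra_simps)
    also have "(L + 1) * h \<le> C * h" unfolding C_def using L h by (intro mult_right_mono) auto
    finally show "V j \<le> W (t + k) (node h j) + E + C * h + \<rho>'" using \<rho> unfolding x_def by linarith
  qed
  show "\<bar>V j - W (t + k) (node h j)\<bar> \<le> E + (6 * L + 2) * h"
    using lower[of j] upper[of j] unfolding C_def by (simp add: abs_le_iff)
  show "V (j + 1) - 2 * V j + V (j - 1) \<le> (2 * L + 1) * h"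
  proof (rule field_le_epsilon)
    fix \<rho>' :: real assume "\<rho>' > 0"
    define \<rho> where "\<rho> = min (\<rho>' / 2) k"
    have \<rho>: "\<rho> > 0" "\<rho> \<le> k" "2 * \<rho> \<le> \<rho>'" using \<open>\<rho>' > 0\<close> k by (auto simp: \<rho>_def)
    define x where "x = node h j"
    obtain a where a: "R (x - k * a) + k * G a < V j + \<rho>"
      using sl_step_approx[OF b legendre_convex less_imp_le[OF k] bdd K0 \<rho>(1), of j]
      unfolding V R_def[symmetric] x_def by blast
    have "W t x \<le> W t (x - k * a) + L * (k * \<bar>a\<bar>)"
      using W_diff_x[OF t, of x "x - k * a"] k by (simp add: abs_mult)
    moreover have "V j \<le> W t x + E + k * G 0"
    proof -
      have "V j \<le> U j + k * G 0"
        using V_le[of 0 j] K Bpos by (simp add: R_node)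
      then show ?thesis using U[of j] unfolding x_def by linarith
    qed
    moreover have "W t (x - k * a) - E - C * h \<le> R (x - k * a)" by (rule R_ge)
    ultimately have "k * (G a - L * \<bar>a\<bar>) \<le> k * G 0 + \<rho> + (2 * E + C * h)"
      using a by (simp add: algebra_simps)
    also have "\<dots> \<le> k * (G 0 + 1 + B)" using \<rho> EB unfolding C_def by (simp add: algebra_simps)
    finally have "\<bar>a\<bar> \<le> G 0 + 1 + B + kap" using k unfolding kap_def by (intro control_bound) simp
    then have aK: "\<bar>a\<bar> \<le> K - 1" using K unfolding kap_def by linarith
    have hk: "\<bar>h / k\<bar> \<le> 1" "k * (h / k) = h" using h k by auto
    have "V (j + 1) \<le> R (x - k * a) + k * G (a + h / k)"
    proof -
      have "node h (j + 1) - k * (a + h / k) = x - k * a"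
        using hk(2) by (simp add: x_def node_def algebra_simps)
      moreover have "\<bar>a + h / k\<bar> \<le> K" using aK hk(1) by linarith
      ultimately show ?thesis using V_le[of "a + h / k" "j + 1"] by simp
    qed
    moreover have "V (j - 1) \<le> R (x - k * a) + k * G (a - h / k)"
    proof -
      have "node h (j - 1) - k * (a - h / k) = x - k * a"
        using hk(2) by (simp add: x_def node_def algebra_simps)
      moreover have "\<bar>a - h / k\<bar> \<le> K" using aK hk(1) by linarith
      ultimately show ?thesis using V_le[of "a - h / k" "j - 1"] by simp
    qed
    moreover have "k * G (a + h / k) + k * G (a - h / k) \<le> 2 * (k * G a) + h"
    proof -
      have "G (a + h / k) + G (a - h / k) \<le> 2 * G a + (h / k)\<^sup>2 / m"
        using legendre_semiconcave[of "1/2" "a + h / k" "a - h / k"] m_pos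
        by (simp add: field_simps power2_eq_square)
      then have "k * (G (a + h / k) + G (a - h / k)) \<le> k * (2 * G a + (h / k)\<^sup>2 / m)"
        using k by (intro mult_left_mono) auto
      also have "\<dots> = 2 * (k * G a) + h / (m * k) * h"
        using k m_pos by (simp add: field_simps power2_eq_square)
      also have "h / (m * k) * h \<le> 1 * h"
        using h k m_pos by (intro mult_right_mono) auto
      finally show ?thesis by (simp add: algebra_simps)
    qed
    ultimately have "V (j + 1) - 2 * V j + V (j - 1) \<le> h + 2 * \<rho>" using a by linarith
    also have "\<dots> \<le> (2 * L + 1) * h + \<rho>'"
      using \<rho> mult_nonneg_nonneg[OF L less_imp_le[OF h(1)]] by (simp add: algebra_simps)
    finally show "V (j + 1) - 2 * V j + V (j - 1) \<le> (2 * L + 1) * h + \<rho>'" .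
  qed
qed

text \<open>The second difference bound of the initial data comes from their Lipschitz constant, hence the
  common bound \<open>(2L+1) h\<close> for all steps. The assumption \<open>h \<le> c k\<^sup>2\<close> makes the accumulated error
  \<open>n h \<le> T c k\<close> of order \<open>k\<close>, as \<open>scheme_step\<close> requires.\<close>

lemma scheme_error:
  assumes h: "0 < h" "h \<le> k" "h \<le> m * k" "h \<le> c * k\<^sup>2" and c: "c \<ge> 0"
    and eps: "\<epsilon> > 0" and d: "0 < d" "d < 7/18"
    and b: "b \<in> rk_weights" and A: "{- K..K} \<subseteq> A"
    and K: "\<bar>G 0\<bar> + \<bar>max (H (L + 1)) (H (- (L + 1)))\<bar> + (6 * L + 2) * (2 * (T * c) + 1) + 2 \<le> K"
    and n: "real n * k \<le> T"
  shows "(\<forall>j. \<bar>sl_scheme kind d l \<epsilon> H v0 A b h k n j - W (real n * k) (node h j)\<bar> \<le> real n * ((6 * L + 2) * h))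
    \<and> (\<forall>j. sl_scheme kind d l \<epsilon> H v0 A b h k n (j + 1) - 2 * sl_scheme kind d l \<epsilon> H v0 A b h k n j
          + sl_scheme kind d l \<epsilon> H v0 A b h k n (j - 1) \<le> (2 * L + 1) * h)"
  using n
proof (induction n)
  case 0
  have "v0 (node h (j + 1)) - 2 * v0 (node h j) + v0 (node h (j - 1)) \<le> (2 * L + 1) * h" for j
    using v0_diff[of "node h (j + 1)" "node h j"] v0_diff[of "node h (j - 1)" "node h j"] h(1)
    by (simp add: node_def algebra_simps)
  then show ?case by (simp add: W_0)
next
  case (Suc n)
  define U where "U = sl_scheme kind d l \<epsilon> H v0 A b h k n"
  define C where "C = 6 * L + 2"
  have k: "k > 0" using h by simp
  have C: "C \<ge> 0" using L_nonneg by (simp add: C_def)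
  have nT: "real n * k \<le> T" using Suc.prems k by (simp add: algebra_simps)
  have IH: "\<And>j. \<bar>U j - W (real n * k) (node h j)\<bar> \<le> real n * (C * h)"
    "\<And>j. U (j + 1) - 2 * U j + U (j - 1) \<le> (2 * L + 1) * h"
    using Suc.IH[OF nT] unfolding U_def C_def by blast+
  have EB: "2 * (real n * (C * h)) + (6 * L + 2) * h \<le> C * (2 * (T * c) + 1) * k"
  proof -
    have "real n * h \<le> real n * (c * k\<^sup>2)" using h by (intro mult_left_mono) auto
    also have "\<dots> = c * (real n * k) * k" by (simp add: power2_eq_square algebra_simps)
    also have "\<dots> \<le> c * T * k" using nT c k by (intro mult_right_mono mult_left_mono) auto
    finally have "C * (2 * (real n * h) + h) \<le> C * (2 * (c * T * k) + k)"
      using h C by (intro mult_left_mono) auto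
    then show ?thesis unfolding C_def by (simp add: algebra_simps)
  qed
  note step = scheme_step[OF h(1-3) eps d _ b A _ EB IH,
      where kind = kind and l = l and V = "sl_scheme kind d l \<epsilon> H v0 A b h k (Suc n)"]
  have V: "sl_scheme kind d l \<epsilon> H v0 A b h k (Suc n) j = sl_step G (recon kind d l \<epsilon> h U) A b k (node h j)" for j
    unfolding U_def by (rule sl_scheme_Suc)
  have t: "real n * k \<ge> 0" using k by simp
  have t': "real (Suc n) * k = real n * k + k" by (simp add: algebra_simps)
  have err: "real (Suc n) * (C * h) = real n * (C * h) + (6 * L + 2) * h" by (simp add: C_def algebra_simps)
  show ?case
    unfolding t' C_def[symmetric] err
    using step[OF t K[folded C_def] V, folded C_def] by blast
qed

end

section \<open>Identification of the viscosity solution\<close>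

text \<open>Uniform continuity provides a step length over which the function changes by at most \<open>\<kappa>\<close>;
  the segment between two points is covered by such steps.\<close>

lemma uniformly_continuous_linear_growth:
  fixes f :: "'a::real_normed_vector \<Rightarrow> real"
  assumes uc: "uniformly_continuous_on S f" and S: "convex S" and \<kappa>: "\<kappa> > 0"
  obtains C where "C \<ge> 0" "\<And>z z'. z \<in> S \<Longrightarrow> z' \<in> S \<Longrightarrow> \<bar>f z - f z'\<bar> \<le> \<kappa> + C * dist z z'"
proof -
  obtain \<delta>' where \<delta>': "\<delta>' > 0" "\<And>z z'. z \<in> S \<Longrightarrow> z' \<in> S \<Longrightarrow> dist z' z < \<delta>' \<Longrightarrow> dist (f z') (f z) < \<kappa>"
    using uc \<kappa> unfolding uniformly_continuous_on_def by meson
  define \<delta> where "\<delta> = \<delta>' / 2"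
  have \<delta>: "\<delta> > 0" "\<And>z z'. z \<in> S \<Longrightarrow> z' \<in> S \<Longrightarrow> dist z z' \<le> \<delta> \<Longrightarrow> \<bar>f z - f z'\<bar> \<le> \<kappa>"
    using \<delta>' unfolding \<delta>_def dist_real_def by (force simp: dist_commute abs_minus_commute)+
  have chain: "\<bar>f z - f z'\<bar> \<le> real n * \<kappa>"
    if "z \<in> S" "z' \<in> S" "dist z z' \<le> real n * \<delta>" for n z z'
    using that
  proof (induction n arbitrary: z)
    case 0 then show ?case by simp
  next
    case (Suc n)
    define t where "t = 1 / real (Suc n)"
    have t: "0 < t" "t \<le> 1" "t * real (Suc n) = 1" "(1 - t) * real (Suc n) = real n"
      by (auto simp: t_def field_simps)
    define w where "w = (1 - t) *\<^sub>R z + t *\<^sub>R z'"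
    have w: "w \<in> S" unfolding w_def using Suc.prems t by (intro convexD[OF S]) auto
    have "z - w = t *\<^sub>R (z - z')" "w - z' = (1 - t) *\<^sub>R (z - z')"
      by (simp_all add: w_def algebra_simps)
    then have d: "dist z w = t * dist z z'" "dist w z' = (1 - t) * dist z z'"
      using t by (simp_all add: dist_norm)
    have "t * dist z z' \<le> t * (real (Suc n) * \<delta>)" "(1 - t) * dist z z' \<le> (1 - t) * (real (Suc n) * \<delta>)"
      using Suc.prems t by (intro mult_left_mono; simp)+
    then have "dist z w \<le> \<delta>" "dist w z' \<le> real n * \<delta>"
      using t(3,4) unfolding d by (simp_all only: mult.assoc[symmetric] mult_1)
    then have "\<bar>f z - f w\<bar> \<le> \<kappa>" "\<bar>f w - f z'\<bar> \<le> real n * \<kappa>"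
      using \<delta>(2)[OF Suc.prems(1) w] Suc.IH[OF w Suc.prems(2)] by auto
    then show ?case by (simp add: algebra_simps)
  qed
  show thesis
  proof (rule that[of "\<kappa> / \<delta>"])
    show "\<kappa> / \<delta> \<ge> 0" using \<kappa> \<delta> by simp
    fix z z' assume z: "z \<in> S" "z' \<in> S"
    define n where "n = nat \<lceil>dist z z' / \<delta>\<rceil>"
    have "real n \<ge> dist z z' / \<delta>" "real n \<le> dist z z' / \<delta> + 1"
      unfolding n_def using \<delta>(1) by (auto simp: le_of_int_ceiling of_nat_nat ceiling_le_iff)
    then have "dist z z' \<le> real n * \<delta>" "real n * \<kappa> \<le> (dist z z' / \<delta> + 1) * \<kappa>"
      using \<delta>(1) \<kappa> by (auto simp: pos_divide_le_eq)
    then show "\<bar>f z - f z'\<bar> \<le> \<kappa> + \<kappa> / \<delta> * dist z z'"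
      using chain[OF z, of n] by (simp add: algebra_simps)
  qed
qed

lemma quadratic_upper: "(M::real) > 0 \<Longrightarrow> C * r - M * r\<^sup>2 \<le> C\<^sup>2 / (4 * M)"
proof -
  assume M: "M > 0"
  have "0 \<le> (2 * M * r - C)\<^sup>2 / (4 * M)" using M by simp
  also have "\<dots> = M * r\<^sup>2 - C * r + C\<^sup>2 / (4 * M)" using M by (simp add: power2_eq_square field_simps)
  finally show ?thesis by simp
qed

lemma quadratic_root_bound:
  fixes M :: real
  assumes "M > 0" "C \<ge> 0" "r \<ge> 0" "0 \<le> A + C * r - M * r\<^sup>2"
  shows "r \<le> (\<bar>A\<bar> + C) / M + 1"
proof (rule ccontr)
  assume "\<not> ?thesis"
  then have r: "r > (\<bar>A\<bar> + C) / M + 1" by simp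
  moreover have nonneg: "(\<bar>A\<bar> + C) / M \<ge> 0" using assms by simp
  ultimately have r1: "r > 1" and "(\<bar>A\<bar> + C) / M < r" by linarith+
  then have "\<bar>A\<bar> + C < M * r" using assms(1) by (simp add: pos_divide_less_eq mult.commute)
  then have "M * r * r > (\<bar>A\<bar> + C) * r"
    using r1 by (intro mult_strict_right_mono) auto
  moreover have "\<bar>A\<bar> * r \<ge> \<bar>A\<bar> * 1" using r1 by (intro mult_left_mono) auto
  ultimately show False using assms(4) by (simp add: power2_eq_square algebra_simps)
qed

text \<open>A smooth increasing penalization in time that is large at \<open>T'\<close> and small at \<open>t1\<close>: it keeps
  maximum points away from the terminal time, and its positive derivative makes the viscosity
  inequalities strict.\<close>

lemma exp_penalty:
  fixes B \<eta> t1 T' :: real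
  assumes "B > 0" "\<eta> > 0" "t1 < T'"
  obtains N where "N > 0" "B * exp (N * (t1 - T')) \<le> \<eta>"
proof -
  have "((\<lambda>N. B * exp (N * (t1 - T'))) \<longlongrightarrow> 0) at_top"
    using assms by real_asymp
  then have "\<forall>\<^sub>F N in at_top. B * exp (N * (t1 - T')) < \<eta>"
    using assms by (intro order_tendstoD) auto
  then have "\<forall>\<^sub>F N in at_top. N > 0 \<and> B * exp (N * (t1 - T')) < \<eta>"
    by (intro eventually_conj eventually_gt_at_top)
  then show thesis using that by (auto dest!: eventually_happens'[rotated] simp: less_imp_le)
qed

lemma eventually_at_strip:
  fixes t x :: real
  assumes "0 < t" "t < T'" "\<And>s y. 0 < s \<Longrightarrow> s < T' \<Longrightarrow> P (s, y)"
  shows "\<forall>\<^sub>F z in at (t, x). P z"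
proof -
  have "open ({0<..<T'} \<times> (UNIV :: real set))" by (intro open_Times) auto
  then have "\<forall>\<^sub>F z in at (t, x). z \<in> {0<..<T'} \<times> UNIV"
    by (rule eventually_at_in_open') (use assms in auto)
  then show ?thesis by eventually_elim (use assms in auto)
qed

context hopf_lax
begin

definition time_lip :: real where "time_lip = \<bar>G 0\<bar> + \<bar>\<kappa>\<bar>"

lemma W_diff:
  "t \<ge> 0 \<Longrightarrow> s \<ge> 0 \<Longrightarrow> \<bar>W t x - W s y\<bar> \<le> L * \<bar>x - y\<bar> + time_lip * \<bar>t - s\<bar>"
  using W_diff_x[of t x y] W_diff_t[of t s y] unfolding time_lip_def by linarith

lemma W_continuous: "continuous_on ({0..} \<times> UNIV) (\<lambda>z. W (fst z) (snd z))"
proof -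
  have "(L + time_lip)-lipschitz_on ({0..} \<times> UNIV) (\<lambda>z. W (fst z) (snd z))"
  proof (rule lipschitz_onI)
    show "0 \<le> L + time_lip" using L_nonneg by (simp add: time_lip_def)
    fix z w :: "real \<times> real" assume "z \<in> {0..} \<times> UNIV" "w \<in> {0..} \<times> UNIV"
    then have "\<bar>W (fst z) (snd z) - W (fst w) (snd w)\<bar> \<le> L * \<bar>snd z - snd w\<bar> + time_lip * \<bar>fst z - fst w\<bar>"
      by (intro W_diff) auto
    also have "\<dots> \<le> L * dist z w + time_lip * dist z w"
      using L_nonneg dist_fst_le[of z w] dist_snd_le[of z w]
      by (intro add_mono mult_left_mono) (auto simp: dist_real_def time_lip_def)
    finally show "dist (W (fst z) (snd z)) (W (fst w) (snd w)) \<le> (L + time_lip) * dist z w"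
      by (simp add: dist_real_def algebra_simps)
  qed
  then show ?thesis by (rule lipschitz_on_continuous_on)
qed

context
  fixes T :: real and v :: "real \<Rightarrow> real \<Rightarrow> real"
  assumes T: "T > 0" and v: "viscosity_solution T H v0 v"
begin

lemma v_modulus:
  assumes "\<eta> > 0"
  obtains C where "C \<ge> 0"
    "\<And>t s x y. t \<in> {0..T} \<Longrightarrow> s \<in> {0..T} \<Longrightarrow> \<bar>v t x - v s y\<bar> \<le> \<eta> + C * (\<bar>t - s\<bar> + \<bar>x - y\<bar>)"
proof -
  have "convex ({0..T} \<times> (UNIV::real set))" by (intro convex_Times) auto
  then obtain C where C: "C \<ge> 0" "\<And>z z'. z \<in> {0..T} \<times> UNIV \<Longrightarrow> z' \<in> {0..T} \<times> UNIV \<Longrightarrow>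
      \<bar>(\<lambda>(t, x). v t x) z - (\<lambda>(t, x). v t x) z'\<bar> \<le> \<eta> + C * dist z z'"
    using uniformly_continuous_linear_growth[of "{0..T} \<times> UNIV" "\<lambda>(t, x). v t x" \<eta>] v assms
    unfolding viscosity_solution_def by metis
  show thesis
  proof (rule that[OF C(1)])
    fix t s x y assume "t \<in> {0..T}" "s \<in> {0..T}"
    then have "\<bar>v t x - v s y\<bar> \<le> \<eta> + C * dist (t, x) (s, y)"
      using C(2)[of "(t, x)" "(s, y)"] by simp
    also have "dist (t, x) (s, y) \<le> \<bar>t - s\<bar> + \<bar>x - y\<bar>"
      unfolding dist_Pair_Pair dist_real_def using sqrt_sum_squares_le_sum_abs[of "\<bar>t - s\<bar>" "\<bar>x - y\<bar>"] by simp
    finally show "\<bar>v t x - v s y\<bar> \<le> \<eta> + C * (\<bar>t - s\<bar> + \<bar>x - y\<bar>)"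
      using C(1) by (simp add: mult_left_mono)
  qed
qed

lemma v_continuous: "continuous_on ({0..T} \<times> UNIV) (\<lambda>z. v (fst z) (snd z))"
  using v uniformly_continuous_imp_continuous unfolding viscosity_solution_def case_prod_unfold by blast

lemma v_0: "v 0 x = v0 x" using v unfolding viscosity_solution_def by blast

lemma subsolution_test:
  assumes "C1_on ({0<..<T} \<times> UNIV) \<phi> \<phi>t \<phi>x" "0 < t" "t < T'" "T' \<le> T"
    "\<And>s y. 0 < s \<Longrightarrow> s < T' \<Longrightarrow> v s y - \<phi> (s, y) \<le> v t x - \<phi> (t, x)"
  shows "\<phi>t (t, x) + H (\<phi>x (t, x)) \<le> 0"
proof -
  have "viscosity_subsolution T H v" using v unfolding viscosity_solution_def by blast
  moreover have "\<forall>\<^sub>F (s, y) in at (t, x). v s y - \<phi> (s, y) \<le> v t x - \<phi> (t, x)"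
    by (rule eventually_at_strip[OF assms(2,3)]) (use assms(5) in auto)
  ultimately show ?thesis using assms(1-4) unfolding viscosity_subsolution_def by simp
qed

lemma supersolution_test:
  assumes "C1_on ({0<..<T} \<times> UNIV) \<phi> \<phi>t \<phi>x" "0 < t" "t < T'" "T' \<le> T"
    "\<And>s y. 0 < s \<Longrightarrow> s < T' \<Longrightarrow> v s y - \<phi> (s, y) \<ge> v t x - \<phi> (t, x)"
  shows "\<phi>t (t, x) + H (\<phi>x (t, x)) \<ge> 0"
proof -
  have "viscosity_supersolution T H v" using v unfolding viscosity_solution_def by blast
  moreover have "\<forall>\<^sub>F (s, y) in at (t, x). v s y - \<phi> (s, y) \<ge> v t x - \<phi> (t, x)"
    by (rule eventually_at_strip[OF assms(2,3)]) (use assms(5) in auto)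
  ultimately show ?thesis using assms(1-4) unfolding viscosity_supersolution_def by simp
qed

text \<open>Since \<open>H p \<ge> a p - G a\<close>, a subsolution of the Hamilton-Jacobi equation is one of the linear
  transport equation with velocity \<open>a\<close> and source \<open>G a\<close>, so it grows at most at rate \<open>G a\<close> along the
  characteristics of that equation. The test function penalizes the distance to
  one characteristic; at an interior maximum the terms from this penalty cancel and only the positive
  derivative of the time penalty remains.\<close>

lemma v_le_characteristic:
  assumes t1: "0 < t1" "t1 < T"
  shows "v t1 (x0 + a * t1) \<le> v0 x0 + t1 * G a"
proof (rule ccontr)
  assume neg: "\<not> ?thesis"
  define x1 where "x1 = x0 + a * t1"
  define \<eta> where "\<eta> = (v t1 x1 - v0 x0 - t1 * G a) / 4"
  have \<eta>: "\<eta> > 0" using neg by (simp add: \<eta>_def x1_def)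
  obtain C where C: "C \<ge> 0"
    "\<And>t s x y. t \<in> {0..T} \<Longrightarrow> s \<in> {0..T} \<Longrightarrow> \<bar>v t x - v s y\<bar> \<le> \<eta> + C * (\<bar>t - s\<bar> + \<bar>x - y\<bar>)"
    using v_modulus[OF \<eta>] by blast
  define T' where "T' = (t1 + T) / 2"
  have T': "t1 < T'" "T' < T" "0 < T'" using t1 by (auto simp: T'_def)
  define M where "M = L\<^sup>2 / (4 * \<eta>) + 1"
  have M: "M > 0" "L\<^sup>2 / (4 * M) \<le> \<eta>"
  proof -
    have "L\<^sup>2 / (4 * \<eta>) \<ge> 0" using \<eta> by simp
    then show M0: "M > 0" by (simp add: M_def)
    have "4 * \<eta> * M = L\<^sup>2 + 4 * \<eta>" using \<eta> by (simp add: M_def field_simps)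
    then have "L\<^sup>2 \<le> \<eta> * (4 * M)" using \<eta> by (simp add: algebra_simps)
    then show "L\<^sup>2 / (4 * M) \<le> \<eta>" using M0 by (simp add: pos_divide_le_eq)
  qed
  define K where "K = v t1 x1 + \<eta> + C * (T + \<bar>a\<bar> * T) + T * \<bar>G a\<bar>"
  define B where "B = C * (T + \<bar>a\<bar> * T) + 2 * (T * \<bar>G a\<bar>) + C\<^sup>2 / (4 * M) + 3 * \<eta>"
  have B: "B > 0" unfolding B_def using C(1) M \<eta> T by (intro add_nonneg_pos add_nonneg_nonneg mult_nonneg_nonneg divide_nonneg_pos) auto
  obtain N where N: "N > 0" "B * exp (N * (t1 - T')) \<le> \<eta>" using exp_penalty[OF B \<eta> T'(1)] by blast
  define \<phi> where "\<phi> z = fst z * G a + M * (snd z - x0 - a * fst z)\<^sup>2 + B * exp (N * (fst z - T'))" for z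
  define \<phi>t where "\<phi>t z = G a - 2 * M * a * (snd z - x0 - a * fst z) + N * B * exp (N * (fst z - T'))" for z
  define \<phi>x where "\<phi>x z = 2 * M * (snd z - x0 - a * fst z)" for z :: "real \<times> real"
  have C1: "C1_on ({0<..<T} \<times> UNIV) \<phi> \<phi>t \<phi>x"
    unfolding C1_on_def
  proof (intro conjI ballI)
    fix z :: "real \<times> real"
    show "(\<phi> has_derivative (\<lambda>h. \<phi>t z * fst h + \<phi>x z * snd h)) (at z)"
      unfolding \<phi>_def \<phi>t_def \<phi>x_def
      by (rule derivative_eq_intros refl | (simp add: fun_eq_iff algebra_simps; fail))+
    show "continuous_on ({0<..<T} \<times> UNIV) \<phi>t" "continuous_on ({0<..<T} \<times> UNIV) \<phi>x"
      unfolding \<phi>t_def \<phi>x_def by (intro continuous_intros)+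
  qed
  define f where "f z = v (fst z) (snd z) - \<phi> z" for z
  have f1: "f (t1, x1) \<ge> v0 x0 + 3 * \<eta>" "f (t1, x1) \<ge> v t1 x1 - t1 * G a - \<eta>"
  proof -
    have "f (t1, x1) = v t1 x1 - t1 * G a - B * exp (N * (t1 - T'))"
      by (simp add: f_def \<phi>_def x1_def)
    moreover have "v t1 x1 = v0 x0 + t1 * G a + 4 * \<eta>" by (simp add: \<eta>_def field_simps)
    ultimately show "f (t1, x1) \<ge> v0 x0 + 3 * \<eta>" "f (t1, x1) \<ge> v t1 x1 - t1 * G a - \<eta>"
      using N(2) by linarith+
  qed
  have up: "f (s, y) \<le> K + C * r - M * r\<^sup>2 - B * exp (N * (s - T'))"
    if "s \<in> {0..T}" "r = \<bar>y - x0 - a * s\<bar>" for s y r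
  proof -
    have "\<bar>y - x1\<bar> \<le> r + \<bar>a\<bar> * T"
    proof -
      have "y - x1 = (y - x0 - a * s) + a * (s - t1)" by (simp add: x1_def algebra_simps)
      then have "\<bar>y - x1\<bar> \<le> r + \<bar>a\<bar> * \<bar>s - t1\<bar>" using that by (metis abs_mult abs_triangle_ineq)
      moreover have "\<bar>a\<bar> * \<bar>s - t1\<bar> \<le> \<bar>a\<bar> * T" using that t1 by (intro mult_left_mono) auto
      ultimately show ?thesis by linarith
    qed
    moreover have "\<bar>s - t1\<bar> \<le> T" using that t1 by auto
    ultimately have "C * (\<bar>s - t1\<bar> + \<bar>y - x1\<bar>) \<le> C * (T + (r + \<bar>a\<bar> * T))"
      by (intro mult_left_mono[OF _ C(1)]) simp
    then have "v s y \<le> v t1 x1 + \<eta> + C * (T + (r + \<bar>a\<bar> * T))"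
      using C(2)[of s t1 y x1] that t1 by (simp add: abs_le_iff)
    moreover have "- (s * G a) \<le> T * \<bar>G a\<bar>"
    proof -
      have "s * (- G a) \<le> s * \<bar>G a\<bar>" by (rule mult_left_mono) (use that in auto)
      also have "\<dots> \<le> T * \<bar>G a\<bar>" using that by (intro mult_right_mono) auto
      finally show ?thesis by simp
    qed
    moreover have "r\<^sup>2 = (y - x0 - a * s)\<^sup>2" using that by simp
    ultimately show ?thesis unfolding f_def \<phi>_def K_def by (simp add: algebra_simps)
  qed
  define r0 where "r0 = (\<bar>K - f (t1, x1)\<bar> + C) / M + 1"
  have r0: "\<bar>y - x0 - a * s\<bar> \<le> r0" if "s \<in> {0..T}" "f (s, y) \<ge> f (t1, x1)" for s y
    unfolding r0_def
  proof (rule quadratic_root_bound[OF M(1) C(1)])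
    have "B * exp (N * (s - T')) \<ge> 0" using B by simp
    then show "0 \<le> K - f (t1, x1) + C * \<bar>y - x0 - a * s\<bar> - M * \<bar>y - x0 - a * s\<bar>\<^sup>2"
      using up[OF that(1) refl, of y] that(2) by linarith
  qed simp
  define Y where "Y = \<bar>x0\<bar> + \<bar>a\<bar> * T + r0"
  have Y: "\<bar>y\<bar> \<le> Y" if "s \<in> {0..T}" "f (s, y) \<ge> f (t1, x1)" for s y
  proof -
    have "\<bar>a * s\<bar> \<le> \<bar>a\<bar> * T" using that by (simp add: abs_mult mult_left_mono)
    then show ?thesis using r0[OF that] unfolding Y_def by linarith
  qed
  have t1m: "t1 \<in> {0..T}" using t1 by auto
  have "\<exists>z\<in>{0..T'} \<times> {- Y..Y}. \<forall>w\<in>{0..T'} \<times> {- Y..Y}. f w \<le> f z"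
  proof (rule continuous_attains_sup)
    show "compact ({0..T'} \<times> {- Y..Y})" by (intro compact_Times) auto
    show "{0..T'} \<times> {- Y..Y} \<noteq> {}" using T' Y[OF t1m order_refl] by auto
    show "continuous_on ({0..T'} \<times> {- Y..Y}) f"
      unfolding f_def \<phi>_def
      by (intro continuous_intros continuous_on_subset[OF v_continuous]) (use T' in auto)
  qed
  then obtain s y where sy: "s \<in> {0..T'}" "y \<in> {- Y..Y}" "\<And>w. w \<in> {0..T'} \<times> {- Y..Y} \<Longrightarrow> f w \<le> f (s, y)"
    by auto
  have "f (t1, x1) \<le> f (s, y)"
    using sy(3)[of "(t1, x1)"] t1 T' Y[OF t1m order_refl] by (auto simp: abs_le_iff)
  have max: "f (s', y') \<le> f (s, y)" if "s' \<in> {0..T'}" for s' y'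
  proof (cases "f (s', y') \<ge> f (t1, x1)")
    case True
    then have "\<bar>y'\<bar> \<le> Y" using that T' by (intro Y[of s']) auto
    then show ?thesis using sy(3)[of "(s', y')"] that by (auto simp: abs_le_iff)
  next
    case False then show ?thesis using \<open>f (t1, x1) \<le> f (s, y)\<close> by linarith
  qed
  have "s \<noteq> 0"
  proof
    assume "s = 0"
    have "L * \<bar>y - x0\<bar> - M * \<bar>y - x0\<bar>\<^sup>2 \<le> \<eta>" using quadratic_upper[OF M(1), of L "\<bar>y - x0\<bar>"] M(2) by linarith
    then have "v0 y - M * (y - x0)\<^sup>2 \<le> v0 x0 + \<eta>" using v0_diff[of y x0] by simp
    moreover have "B * exp (N * (0 - T')) \<ge> 0" using B by simp
    ultimately have "f (s, y) \<le> v0 x0 + \<eta>" unfolding f_def \<phi>_def \<open>s = 0\<close> by (simp add: v_0)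
    then show False using f1(1) \<open>f (t1, x1) \<le> f (s, y)\<close> \<eta> by linarith
  qed
  moreover have "s \<noteq> T'"
  proof
    assume "s = T'"
    have "C * r - M * r\<^sup>2 \<le> C\<^sup>2 / (4 * M)" for r by (rule quadratic_upper[OF M(1)])
    then have "C * \<bar>y - x0 - a * s\<bar> - M * \<bar>y - x0 - a * s\<bar>\<^sup>2 \<le> C\<^sup>2 / (4 * M)" .
    moreover have "B * exp (N * (s - T')) = B" using \<open>s = T'\<close> by simp
    moreover have "s \<in> {0..T}" using \<open>s = T'\<close> T' by simp
    ultimately have "f (s, y) \<le> K + C\<^sup>2 / (4 * M) - B"
      using up[of s "\<bar>y - x0 - a * s\<bar>" y] by linarith
    moreover have "- (t1 * G a) \<ge> - (T * \<bar>G a\<bar>)"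
    proof -
      have "t1 * G a \<le> t1 * \<bar>G a\<bar>" using t1 by (intro mult_left_mono) auto
      also have "\<dots> \<le> T * \<bar>G a\<bar>" using t1 by (intro mult_right_mono) auto
      finally show ?thesis by simp
    qed
    ultimately show False using f1(2) \<open>f (t1, x1) \<le> f (s, y)\<close> \<eta> unfolding K_def B_def by linarith
  qed
  ultimately have s: "0 < s" "s < T'" using sy(1) by auto
  have "\<phi>t (s, y) + H (\<phi>x (s, y)) \<le> 0"
    by (rule subsolution_test[OF C1 s]) (use T' max in \<open>auto simp: f_def\<close>)
  moreover have "a * \<phi>x (s, y) - H (\<phi>x (s, y)) \<le> G a" by (rule young)
  moreover have "N * B * exp (N * (s - T')) > 0" using N B by simp
  ultimately show False unfolding \<phi>t_def \<phi>x_def by (simp add: algebra_simps)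
qed

lemma v_le_W:
  assumes "0 < t" "t < T" shows "v t x \<le> W t x"
proof (rule W_ge)
  fix a show "v t x \<le> v0 (x - a * t) + t * G a"
    using v_le_characteristic[OF assms, of "x - a * t" a] by simp
qed


text \<open>Doubling of variables. At a maximum of
  \<open>W(t,x) - v(s,y) - M(|x-y|\<^sup>2 + |t-s|\<^sup>2) - \<beta>|x-x1|\<^sup>2 - q(s)\<close> the supersolution property is used for \<open>v\<close>,
  whereas for \<open>W\<close> the inequality \<open>W_dpp_le\<close> is used directly, going back along every velocity \<open>a\<close>.
  The two momenta differ by \<open>2\<beta>(x-x1)\<close>, which tends to zero with \<open>\<beta>\<close>, while the
  derivative of \<open>q\<close> separates the two inequalities by a fixed amount. A large \<open>M\<close> forces the
  maximum away from the initial time, where both functions equal \<open>v0\<close>.\<close>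

lemma W_le_v:
  assumes t1: "0 < t1" "t1 < T"
  shows "W t1 x1 \<le> v t1 x1"
proof (rule ccontr)
  assume neg: "\<not> ?thesis"
  define \<eta> where "\<eta> = (W t1 x1 - v t1 x1) / 4"
  have \<eta>: "\<eta> > 0" using neg by (simp add: \<eta>_def)
  obtain C where C: "C \<ge> 0"
    "\<And>t s x y. t \<in> {0..T} \<Longrightarrow> s \<in> {0..T} \<Longrightarrow> \<bar>v t x - v s y\<bar> \<le> \<eta> + C * (\<bar>t - s\<bar> + \<bar>x - y\<bar>)"
    using v_modulus[OF \<eta>] by blast
  have D0: "time_lip \<ge> 0" by (simp add: time_lip_def)
  define T' where "T' = (t1 + T) / 2"
  have T': "t1 < T'" "T' < T" "0 < T'" using t1 by (auto simp: T'_def)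
  define K where "K = time_lip * T + C * T + 3 * \<eta>"
  define M where "M = ((L + time_lip)\<^sup>2 + C\<^sup>2) / (2 * \<eta>) + 1"
  have M: "M > 0" "(L + time_lip)\<^sup>2 / (2 * M) \<le> \<eta>" "C\<^sup>2 / (2 * M) \<le> \<eta>"
  proof -
    have "((L + time_lip)\<^sup>2 + C\<^sup>2) / (2 * \<eta>) \<ge> 0" using \<eta> by simp
    then show M0: "M > 0" by (simp add: M_def)
    have "2 * \<eta> * M = (L + time_lip)\<^sup>2 + C\<^sup>2 + 2 * \<eta>" using \<eta> by (simp add: M_def field_simps)
    then have "(L + time_lip)\<^sup>2 \<le> \<eta> * (2 * M)" "C\<^sup>2 \<le> \<eta> * (2 * M)"
      using \<eta> zero_le_power2[of "L + time_lip"] zero_le_power2[of C] by (simp_all add: mult.commute mult.left_commute)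
    then show "(L + time_lip)\<^sup>2 / (2 * M) \<le> \<eta>" "C\<^sup>2 / (2 * M) \<le> \<eta>" using M0 by (simp_all add: pos_divide_le_eq)
  qed
  define B where "B = K + \<eta>"
  have K: "K > 0" unfolding K_def using D0 C(1) T \<eta> by (intro add_nonneg_pos add_nonneg_nonneg) auto
  have B: "B > 0" using K \<eta> by (simp add: B_def)
  obtain N where N: "N > 0" "B * exp (N * (t1 - T')) \<le> \<eta>" using exp_penalty[OF B \<eta> T'(1)] by blast
  define q where "q s = B * exp (N * (s - T'))" for s
  have q: "q s \<ge> 0" "q t1 \<le> \<eta>" "q T' = B" for s using B N by (auto simp: q_def)
  define \<delta> where "\<delta> = N * B * exp (- (N * T'))"
  have \<delta>: "\<delta> > 0" using N B by (simp add: \<delta>_def)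
  have dq: "\<delta> \<le> N * q s" if "s \<ge> 0" for s
    using N B that unfolding \<delta>_def q_def by (simp add: algebra_simps)

  \<comment> \<open>The bounds \<open>K\<close> and \<open>R\<close> do not involve \<open>\<beta>\<close>, which is chosen after them.\<close>
  have vW: "W t x - v s y \<le> K - \<eta> + C * (\<bar>x - y\<bar> + \<bar>t - s\<bar>)" if "t \<in> {0..T}" "s \<in> {0..T}" for t s x y
  proof -
    have "W t x \<le> W 0 x + time_lip * t" using W_diff[of t 0 x x] that by simp
    also have "W 0 x = v 0 x" by (simp add: W_0 v_0)
    also have "v 0 x \<le> v t x + \<eta> + C * t" using C(2)[of 0 t x x] that T by simp
    also have "v t x \<le> v s y + \<eta> + C * (\<bar>t - s\<bar> + \<bar>x - y\<bar>)" using C(2)[of t s x y] that by (simp add: abs_le_iff)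
    finally have "W t x \<le> v s y + 2 * \<eta> + C * (\<bar>t - s\<bar> + \<bar>x - y\<bar>) + (time_lip * t + C * t)" by linarith
    moreover have "time_lip * t \<le> time_lip * T" "C * t \<le> C * T" using that C(1) D0 by (auto intro!: mult_left_mono)
    ultimately show ?thesis unfolding K_def by (simp add: algebra_simps)
  qed
  define r where "r t x s y = \<bar>x - y\<bar> + \<bar>t - s\<bar>" for t x s y :: real
  have r0: "r t x s y \<ge> 0" for t x s y by (simp add: r_def)
  have r2: "(r t x s y)\<^sup>2 / 2 \<le> (x - y)\<^sup>2 + (t - s)\<^sup>2" for t x s y
  proof -
    have "(\<bar>a\<bar> + \<bar>b\<bar>)\<^sup>2 / 2 \<le> a\<^sup>2 + b\<^sup>2" for a b :: real
    proof -
      have "0 \<le> (\<bar>a\<bar> - \<bar>b\<bar>)\<^sup>2" by simp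
      then show ?thesis by (simp add: power2_diff power2_sum)
    qed
    from this[of "x - y" "t - s"] show ?thesis unfolding r_def .
  qed
  have Mr: "M * ((x - y)\<^sup>2 + (t - s)\<^sup>2) \<ge> M / 2 * (r t x s y)\<^sup>2" for t x s y
    using mult_left_mono[OF r2[of t x s y], of M] M(1) by simp
  have quad: "c * z - M / 2 * z\<^sup>2 \<le> \<eta>" if "c = L + time_lip \<or> c = C" for c z
    using quadratic_upper[of "M / 2" c z] M that by auto
  define R where "R = (\<bar>K\<bar> + C) / (M / 2) + 1"
  have "uniformly_continuous_on (cball 0 (2 * M * R + 1)) H"
    by (intro compact_uniformly_continuous continuous_on_subset[OF hamiltonian_continuous]) auto
  then obtain \<mu>' where \<mu>': "\<mu>' > 0" "\<And>p p'. p \<in> cball 0 (2 * M * R + 1) \<Longrightarrow> p' \<in> cball 0 (2 * M * R + 1) \<Longrightarrow>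
      dist p' p < \<mu>' \<Longrightarrow> dist (H p') (H p) < \<delta>"
    unfolding uniformly_continuous_on_def using \<delta> by meson
  define \<mu> where "\<mu> = min \<mu>' 1"
  have \<mu>: "\<mu> > 0" "\<mu> \<le> 1" "\<mu> \<le> \<mu>'" using \<mu>' by (auto simp: \<mu>_def)
  define \<beta> where "\<beta> = \<mu>\<^sup>2 / (8 * K)"
  have \<beta>: "\<beta> > 0" "4 * \<beta> * K < \<mu>\<^sup>2" using \<mu> K by (auto simp: \<beta>_def)

  define F where "F t x s y = W t x - v s y - M * ((x - y)\<^sup>2 + (t - s)\<^sup>2) - \<beta> * (x - x1)\<^sup>2 - q s" for t x s y
  have F0: "F t1 x1 t1 x1 \<ge> 3 * \<eta>"
    using q(2) by (simp add: F_def \<eta>_def)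
  have Fup: "F t x s y \<le> K + (C * r t x s y - M / 2 * (r t x s y)\<^sup>2) - \<eta> - \<beta> * (x - x1)\<^sup>2 - q s"
    if "t \<in> {0..T}" "s \<in> {0..T}" for t x s y
    using vW[OF that, of x y] Mr[of t x s y] unfolding F_def r_def[symmetric] by simp
  have level: "r t x s y \<le> R \<and> \<beta> * (x - x1)\<^sup>2 \<le> K"
    if "t \<in> {0..T}" "s \<in> {0..T}" "F t x s y \<ge> F t1 x1 t1 x1" for t x s y
  proof
    have b: "\<beta> * (x - x1)\<^sup>2 \<ge> 0" using \<beta> by simp
    show "r t x s y \<le> R" unfolding R_def
    proof (rule quadratic_root_bound)
      show "0 \<le> K + C * r t x s y - M / 2 * (r t x s y)\<^sup>2"
        using Fup[OF that(1,2), of x y] that(3) F0 b q(1)[of s] \<eta> by linarith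
    qed (use M C r0 in auto)
    show "\<beta> * (x - x1)\<^sup>2 \<le> K"
      using Fup[OF that(1,2), of x y] that(3) F0 q(1)[of s] \<eta> quad[of C "r t x s y"] by auto
  qed
  define X where "X = K / \<beta> + 1"
  have X: "\<bar>x - x1\<bar> \<le> X" if "\<beta> * (x - x1)\<^sup>2 \<le> K" for x
  proof -
    have "(x - x1)\<^sup>2 \<le> K / \<beta>" using that \<beta> by (simp add: pos_le_divide_eq mult.commute)
    moreover have "\<bar>x - x1\<bar> \<le> (x - x1)\<^sup>2 + 1"
    proof -
      have "\<bar>a\<bar> \<le> a\<^sup>2 + 1" for a :: real
      proof -
        have "0 \<le> (\<bar>a\<bar> - 1)\<^sup>2" by simp
        then have "2 * \<bar>a\<bar> \<le> a\<^sup>2 + 1" by (simp add: power2_diff)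
        then show ?thesis using abs_ge_zero[of a] by linarith
      qed
      from this[of "x - x1"] show ?thesis .
    qed
    ultimately show ?thesis by (simp add: X_def)
  qed
  define S where "S = {0..T} \<times> {x1 - X..x1 + X} \<times> {0..T'} \<times> {x1 - X - R..x1 + X + R}"
  define f where "f z = F (fst z) (fst (snd z)) (fst (snd (snd z))) (snd (snd (snd z)))" for z
  have inS: "(t, x, s, y) \<in> S" if "t \<in> {0..T}" "s \<in> {0..T'}" "F t x s y \<ge> F t1 x1 t1 x1" for t x s y
  proof -
    have "r t x s y \<le> R" "\<bar>x - x1\<bar> \<le> X" using level[of t s x y] X[of x] that T' by auto
    then have "\<bar>x - y\<bar> \<le> R" "\<bar>x - x1\<bar> \<le> X" by (auto simp: r_def)
    then show ?thesis using that by (auto simp: S_def)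
  qed
  have P0: "(t1, x1, t1, x1) \<in> S" using inS t1 T' by auto
  have "\<exists>z\<in>S. \<forall>w\<in>S. f w \<le> f z"
  proof (rule continuous_attains_sup)
    show "compact S" unfolding S_def by (intro compact_Times) auto
    show "S \<noteq> {}" using P0 by auto
    have "continuous_on S (\<lambda>z. W (fst (fst z, fst (snd z))) (snd (fst z, fst (snd z))))"
      by (rule continuous_on_compose2[OF W_continuous]) (auto intro!: continuous_intros simp: S_def)
    moreover have "continuous_on S (\<lambda>z. v (fst (snd (snd z))) (snd (snd (snd z))))"
      by (rule continuous_on_compose2[OF v_continuous, of S "\<lambda>z. snd (snd z)"])
        (use T' in \<open>auto intro!: continuous_intros simp: S_def\<close>)
    ultimately show "continuous_on S f" unfolding f_def F_def q_def fst_conv snd_conv by (intro continuous_intros)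
  qed
  then obtain z0 where "z0 \<in> S" and z0: "\<forall>w\<in>S. f w \<le> f z0" by blast
  moreover obtain t x s y where "z0 = (t, x, s, y)" by (metis surj_pair)
  moreover have "f (t, x, s, y) = F t x s y" for t x s y by (simp add: f_def)
  ultimately have z: "(t, x, s, y) \<in> S" "\<And>w. w \<in> S \<Longrightarrow> f w \<le> F t x s y" by auto
  have Fm: "F t1 x1 t1 x1 \<le> F t x s y" using z(2)[OF P0] by (simp add: f_def)
  have max: "F t' x' s' y' \<le> F t x s y" if "t' \<in> {0..T}" "s' \<in> {0..T'}" for t' x' s' y'
  proof (cases "F t' x' s' y' \<ge> F t1 x1 t1 x1")
    case True then show ?thesis using z(2)[OF inS[OF that True]] by (simp add: f_def)
  next
    case False then show ?thesis using Fm by linarith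
  qed
  have ts: "0 \<le> t" "t \<le> T" "0 \<le> s" "s \<le> T'" using z(1) by (auto simp: S_def)
  have b: "\<beta> * (x - x1)\<^sup>2 \<ge> 0" using \<beta> by simp
  have "s \<noteq> 0"
  proof
    assume "s = 0"
    have "W t x - v s y \<le> L * \<bar>x - y\<bar> + time_lip * \<bar>t - s\<bar>"
      using W_diff[of t 0 x y] ts by (simp add: W_0 v_0 \<open>s = 0\<close>)
    also have "\<dots> \<le> (L + time_lip) * r t x s y"
      using L_nonneg D0 by (simp add: r_def algebra_simps)
    finally have "F t x s y \<le> (L + time_lip) * r t x s y - M / 2 * (r t x s y)\<^sup>2"
      using Mr[of t x s y] b q(1)[of s] unfolding F_def r_def[symmetric] by linarith
    then show False using quad[of "L + time_lip" "r t x s y"] Fm F0 \<eta> by simp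
  qed
  have "t \<noteq> 0"
  proof
    assume "t = 0"
    have "W t x - v s y \<le> \<eta> + C * r t x s y"
      using C(2)[of 0 s x y] ts T' by (simp add: W_0 v_0 \<open>t = 0\<close> r_def add.commute)
    then have "F t x s y \<le> \<eta> + (C * r t x s y - M / 2 * (r t x s y)\<^sup>2)"
      using Mr[of t x s y] b q(1)[of s] unfolding F_def r_def[symmetric] by linarith
    then show False using quad[of C "r t x s y"] Fm F0 \<eta> by simp
  qed
  have "s \<noteq> T'"
  proof
    assume "s = T'"
    then show False
      using Fup[of t s x y] quad[of C "r t x s y"] b q(3) Fm F0 \<eta> ts T' by (auto simp: B_def)
  qed
  have st: "0 < t" "0 < s" "s < T'" using ts \<open>s \<noteq> 0\<close> \<open>t \<noteq> 0\<close> \<open>s \<noteq> T'\<close> by auto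
  define p where "p = 2 * M * (x - y)"
  define P where "P = p + 2 * \<beta> * (x - x1)"

  \<comment> \<open>The variables \<open>(t, x)\<close> are frozen at the maximum point.\<close>
  have super: "2 * M * (t - s) - N * q s + H p \<ge> 0"
  proof -
    define \<phi> where "\<phi> z = - M * ((x - snd z)\<^sup>2 + (t - fst z)\<^sup>2) - B * exp (N * (fst z - T'))" for z
    define \<phi>t where "\<phi>t z = 2 * M * (t - fst z) - N * B * exp (N * (fst z - T'))" for z :: "real \<times> real"
    define \<phi>x where "\<phi>x z = 2 * M * (x - snd z)" for z :: "real \<times> real"
    have C1: "C1_on ({0<..<T} \<times> UNIV) \<phi> \<phi>t \<phi>x"
      unfolding C1_on_def
    proof (intro conjI ballI)
      fix z :: "real \<times> real"
      show "(\<phi> has_derivative (\<lambda>h. \<phi>t z * fst h + \<phi>x z * snd h)) (at z)"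
        unfolding \<phi>_def \<phi>t_def \<phi>x_def
        by (rule derivative_eq_intros refl | (simp add: fun_eq_iff algebra_simps; fail))+
      show "continuous_on ({0<..<T} \<times> UNIV) \<phi>t" "continuous_on ({0<..<T} \<times> UNIV) \<phi>x"
        unfolding \<phi>t_def \<phi>x_def by (intro continuous_intros)+
    qed
    have "\<phi>t (s, y) + H (\<phi>x (s, y)) \<ge> 0"
    proof (rule supersolution_test[OF C1 st(2,3)])
      show "T' \<le> T" using T' by simp
      fix s' y' assume "0 < s'" "s' < T'"
      then show "v s' y' - \<phi> (s', y') \<ge> v s y - \<phi> (s, y)"
        using max[of t s' x y'] ts unfolding F_def \<phi>_def q_def by simp
    qed
    then show ?thesis by (simp add: \<phi>t_def \<phi>x_def q_def p_def)
  qed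

  \<comment> \<open>The variables \<open>(s, y)\<close> are frozen, and \<open>(t, x)\<close> moves back by \<open>k (1, a)\<close> with \<open>k\<close> small.\<close>
  have sub: "H P \<le> - (2 * M * (t - s))"
  proof -
    have "a * P + 2 * M * (t - s) \<le> G a" for a
    proof (rule field_le_epsilon)
      fix e :: real assume e: "e > 0"
      define Z where "Z = M * a\<^sup>2 + M + \<beta> * a\<^sup>2"
      have Z: "Z > 0" using M \<beta> by (simp add: Z_def add_nonneg_pos add_pos_nonneg)
      define k where "k = min t (e / Z)"
      have k: "0 < k" "k \<le> t" "k \<le> e / Z" using st e Z by (auto simp: k_def)
      then have kZ: "k * Z \<le> e" using Z by (simp add: pos_le_divide_eq)
      have "W t x \<le> W (t - k) (x - k * a) + k * G a"
        using W_dpp_le[of "t - k" k x a] k by simp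
      moreover have "F (t - k) (x - k * a) s y \<le> F t x s y" using k ts by (intro max) auto
      ultimately have "M * ((x - y)\<^sup>2 + (t - s)\<^sup>2) - M * ((x - k * a - y)\<^sup>2 + (t - k - s)\<^sup>2)
          + \<beta> * (x - x1)\<^sup>2 - \<beta> * (x - k * a - x1)\<^sup>2 \<le> k * G a"
        unfolding F_def by linarith
      also have "M * ((x - y)\<^sup>2 + (t - s)\<^sup>2) - M * ((x - k * a - y)\<^sup>2 + (t - k - s)\<^sup>2)
          + \<beta> * (x - x1)\<^sup>2 - \<beta> * (x - k * a - x1)\<^sup>2 = k * (a * P + 2 * M * (t - s) - k * Z)"
        unfolding P_def p_def Z_def by (simp add: power2_eq_square algebra_simps)
      finally have "a * P + 2 * M * (t - s) - k * Z \<le> G a" using k(1) by simp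
      then show "a * P + 2 * M * (t - s) \<le> G a + e" using kZ by linarith
    qed
    then have *: "a * P + 2 * M * (t - s) \<le> G a" for a .
    obtain a where "H P = a * P - G a" using biconjugate[of P] by blast
    then show ?thesis using *[of a] by linarith
  qed

  have lev: "r t x s y \<le> R" "\<beta> * (x - x1)\<^sup>2 \<le> K" using level[of t s x y] Fm ts T' by auto
  have "\<bar>p\<bar> \<le> 2 * M * R"
  proof -
    have "\<bar>p\<bar> = 2 * M * \<bar>x - y\<bar>" using M by (simp add: p_def abs_mult)
    also have "\<dots> \<le> 2 * M * R" using lev(1) M by (intro mult_left_mono) (auto simp: r_def)
    finally show ?thesis .
  qed
  moreover have "\<bar>P - p\<bar> < \<mu>"
  proof (rule power2_less_imp_less)
    have "\<bar>P - p\<bar>\<^sup>2 = 4 * \<beta> * (\<beta> * (x - x1)\<^sup>2)" by (simp add: P_def power2_eq_square)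
    also have "\<dots> \<le> 4 * \<beta> * K" using lev(2) \<beta> by (intro mult_left_mono) auto
    also have "\<dots> < \<mu>\<^sup>2" by (rule \<beta>(2))
    finally show "\<bar>P - p\<bar>\<^sup>2 < \<mu>\<^sup>2" .
  qed (use \<mu> in simp)
  ultimately have "dist (H P) (H p) < \<delta>"
    using \<mu> by (intro \<mu>'(2)) (auto simp: dist_real_def abs_le_iff abs_less_iff)
  then show False using super sub dq[OF ts(3)] by (simp add: dist_real_def abs_less_iff)
qed

lemma v_eq_W:
  assumes "t \<in> {0..T}" shows "v t x = W t x"
proof -
  have pair: "continuous_on {0..T} (\<lambda>t. (t, x))" by (intro continuous_intros)
  have "continuous_on {0..T} (\<lambda>t. v (fst (t, x)) (snd (t, x)))"
    by (rule continuous_on_compose2[OF v_continuous pair]) auto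
  moreover have "continuous_on {0..T} (\<lambda>t. W (fst (t, x)) (snd (t, x)))"
    by (rule continuous_on_compose2[OF W_continuous pair]) auto
  ultimately have "continuous_on (closure {0<..<T}) (\<lambda>t. v t x - W t x)"
    using T by (auto intro!: continuous_intros)
  moreover have "v t x - W t x = 0" if "t \<in> {0<..<T}" for t
    using v_le_W[of t x] W_le_v[of t x] that by auto
  moreover have "t \<in> closure {0<..<T}" using assms T by simp
  ultimately have "v t x - W t x = 0" by (rule continuous_constant_on_closure)
  then show ?thesis by simp
qed

end
end

section \<open>Convergence\<close>

lemma lipschitz_deriv_bound:
  fixes f :: "real \<Rightarrow> real"
  assumes f: "L-lipschitz_on UNIV f" and p: "(f has_real_derivative p) (at x)"
  shows "\<bar>p\<bar> \<le> L"
proof (rule tendsto_upperbound)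
  show "((\<lambda>h. \<bar>(f (x + h) - f x) / h\<bar>) \<longlongrightarrow> \<bar>p\<bar>) (at 0)"
    using p unfolding DERIV_def by (rule tendsto_rabs)
  show "\<forall>\<^sub>F h in at 0. \<bar>(f (x + h) - f x) / h\<bar> \<le> L"
    unfolding eventually_at_filter
  proof (rule always_eventually, intro allI impI)
    fix h :: real assume "h \<noteq> 0"
    then show "\<bar>(f (x + h) - f x) / h\<bar> \<le> L"
      using lipschitz_onD[OF f, of "x + h" x] by (simp add: dist_real_def pos_divide_le_eq)
  qed
qed simp

theorem mainTheorem1:
  fixes T m\<^sub>H d l C\<^sub>2 C\<^sub>3 :: real
    and v0 H H2 :: "real \<Rightarrow> real"
    and v :: "real \<Rightarrow> real \<Rightarrow> real"
    and kind :: cweno_kind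
    and \<epsilon> :: "real \<Rightarrow> real"
  assumes "T > 0"
    and "\<exists>L. L-lipschitz_on UNIV v0"
    and "W2_inf H H2" and "m\<^sub>H > 0" and "AE p in lebesgue. H2 p \<ge> m\<^sub>H"
    and "viscosity_solution T H v0 v"
    and "d > 0" and "1 - 2*d > 0" and "l \<ge> 1" and "\<And>dx. dx > 0 \<Longrightarrow> \<epsilon> dx > 0"
    and "quadratic_const C\<^sub>2" and "cubic_const C\<^sub>3"
    and "1 / (1 - 2*d) * C\<^sub>3 + 2*d / (1 - 2*d) * C\<^sub>2 < 1"
  shows "(\<exists>C<1. \<forall>dx>0. \<forall>w. (\<exists>L. L-lipschitz_on UNIV w) \<longrightarrow>
            (let W = (\<lambda>j. w (node dx j)) in
              (\<forall>k. recon kind d l (\<epsilon> dx) dx W (node dx k) = w (node dx k)) \<and>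
              (\<forall>x. \<bar>recon kind d l (\<epsilon> dx) dx W x - lin_interp dx W x\<bar>
                     \<le> C * max_second_diff dx W x)))
       \<and> (\<forall>dx b. (\<forall>dt>0. dx dt > 0) \<longrightarrow> dx \<in> O[at_right 0](\<lambda>dt. dt\<^sup>2) \<longrightarrow> b \<in> rk_weights \<longrightarrow>
            (\<exists>A\<^sub>0. compact A\<^sub>0 \<and> (\<forall>A. compact A \<longrightarrow> A\<^sub>0 \<subseteq> A \<longrightarrow>
               (\<forall>t\<in>{0<..<T}. \<forall>x p. (v t has_real_derivative p) (at x) \<longrightarrow>
                  H p = (SUP a\<in>A. a * p - legendre H a)) \<and>
               (\<forall>e>0. \<forall>\<^sub>F dt in at_right 0. \<forall>n. real n \<le> T / dt \<longrightarrow>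
                  (\<forall>x. \<bar>recon kind d l (\<epsilon> (dx dt)) (dx dt)
                           (sl_scheme kind d l (\<epsilon> (dx dt)) H v0 A b (dx dt) dt n) x
                        - v (real n * dt) x\<bar> \<le> e)))))"
proof (intro conjI allI impI)
  have "1/8 \<le> C\<^sub>2" "1/8 \<le> C\<^sub>3" using interpolation_const_ge assms(11,12) by auto
  then have "1 / (1 - 2*d) * (1/8) + 2*d / (1 - 2*d) * (1/8) \<le> 1 / (1 - 2*d) * C\<^sub>3 + 2*d / (1 - 2*d) * C\<^sub>2"
    using assms(7,8) by (intro add_mono mult_left_mono) auto
  then have "1 / (1 - 2*d) * (1/8) + 2*d / (1 - 2*d) * (1/8) < 1" using assms(13) by linarith
  then have C1: "(1 + 2*d) / (1 - 2*d) / 8 < 1" by (simp add: add_divide_distrib)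
  then have d: "0 < d" "d < 7/18" using assms(7,8) by (auto simp: pos_divide_less_eq)
  show "\<exists>C<1. \<forall>dx>0. \<forall>w. (\<exists>L. L-lipschitz_on UNIV w) \<longrightarrow>
            (let W = (\<lambda>j. w (node dx j)) in
              (\<forall>k. recon kind d l (\<epsilon> dx) dx W (node dx k) = w (node dx k)) \<and>
              (\<forall>x. \<bar>recon kind d l (\<epsilon> dx) dx W x - lin_interp dx W x\<bar>
                     \<le> C * max_second_diff dx W x))"
    unfolding Let_def
    using C1 recon_node[OF _ assms(10) d] recon_lin_interp_dist[OF _ assms(10) d] by blast

  fix dx :: "real \<Rightarrow> real" and b
  assume dx: "\<forall>dt>0. dx dt > 0" and O: "dx \<in> O[at_right 0](\<lambda>dt. dt\<^sup>2)" and b: "b \<in> rk_weights"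
  obtain L where L: "L-lipschitz_on UNIV v0" using assms(2) by blast
  interpret hopf_lax H m\<^sub>H v0 L
    by unfold_locales (use assms(4) W2_inf_strongly_convex[OF assms(3,5)] L in auto)
  note vW = v_eq_W[OF assms(1,6)]
  obtain c where c: "c > 0" "\<forall>\<^sub>F dt in at_right 0. norm (dx dt) \<le> c * norm (dt\<^sup>2)"
    using O by (elim landau_o.bigE)
  define C where "C = 6 * L + 2"
  have C: "C \<ge> 0" using L_nonneg by (simp add: C_def)
  define K1 where "K1 = \<bar>legendre H 0\<bar> + \<bar>max (H (L + 1)) (H (- (L + 1)))\<bar> + C * (2 * (T * c) + 1) + 2"
  obtain K2 where K2: "\<And>p. \<bar>p\<bar> \<le> L \<Longrightarrow> \<exists>a. \<bar>a\<bar> \<le> K2 \<and> H p = a * p - legendre H a"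
    using biconjugate_bounded by blast
  \<comment> \<open>\<open>K1\<close> contains all nearly optimal controls of the scheme, \<open>K2\<close> the maximizing velocities for the
    momenta that occur in the solution.\<close>
  define K where "K = max K1 K2"
  have K12: "K1 \<le> K" "K2 \<le> K" by (simp_all add: K_def)
  show "\<exists>A\<^sub>0. compact A\<^sub>0 \<and> (\<forall>A. compact A \<longrightarrow> A\<^sub>0 \<subseteq> A \<longrightarrow>
               (\<forall>t\<in>{0<..<T}. \<forall>x p. (v t has_real_derivative p) (at x) \<longrightarrow>
                  H p = (SUP a\<in>A. a * p - legendre H a)) \<and>
               (\<forall>e>0. \<forall>\<^sub>F dt in at_right 0. \<forall>n. real n \<le> T / dt \<longrightarrow>
                  (\<forall>x. \<bar>recon kind d l (\<epsilon> (dx dt)) (dx dt)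
                           (sl_scheme kind d l (\<epsilon> (dx dt)) H v0 A b (dx dt) dt n) x
                        - v (real n * dt) x\<bar> \<le> e)))"
  proof (intro exI[of _ "{- K..K}"] conjI allI impI ballI)
    fix A assume A: "{- K..K} \<subseteq> A"
    {
      fix t x p assume t: "t \<in> {0<..<T}" and p: "(v t has_real_derivative p) (at x)"
      have "v t = W t" using vW t by (auto simp: fun_eq_iff)
      then have "\<bar>p\<bar> \<le> L" using lipschitz_deriv_bound[OF W_lipschitz_x[of t], of p x] p t by auto
      then obtain a where a: "\<bar>a\<bar> \<le> K2" "H p = a * p - legendre H a" using K2 by blast
      have "a \<in> {- K..K}" using a(1) K12 by auto
      then have "a \<in> A" using A by blast
      have "(SUP a\<in>A. a * p - legendre H a) = H p"
      proof (intro cSup_eq_maximum)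
        show "H p \<in> (\<lambda>a. a * p - legendre H a) ` A" using \<open>a \<in> A\<close> a(2) by auto
        show "z \<le> H p" if "z \<in> (\<lambda>a. a * p - legendre H a) ` A" for z
          using that young[of _ p] by (auto simp: algebra_simps)
      qed
      then show "H p = (SUP a\<in>A. a * p - legendre H a)" by simp
    }
    fix e :: real assume e: "e > 0"
    define Q where "Q = 5 * C * (T * c) + 3 * L + 1"
    have Q: "Q > 0" using C L_nonneg assms(1) c(1) by (simp add: Q_def add_nonneg_pos)
    define \<delta> where "\<delta> = min (min (1 / c) (m\<^sub>H / c)) (e / Q)"
    have \<delta>: "\<delta> > 0" using c(1) assms(4) e Q by (simp add: \<delta>_def)
    show "\<forall>\<^sub>F dt in at_right 0. \<forall>n. real n \<le> T / dt \<longrightarrow>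
                  (\<forall>x. \<bar>recon kind d l (\<epsilon> (dx dt)) (dx dt)
                           (sl_scheme kind d l (\<epsilon> (dx dt)) H v0 A b (dx dt) dt n) x
                        - v (real n * dt) x\<bar> \<le> e)"
      using c(2) eventually_at_right_real[OF \<delta>]
    proof eventually_elim
      case (elim dt)
      define h where "h = dx dt"
      have dt: "dt > 0" "dt < \<delta>" using elim(2) by auto
      have h: "h > 0" "h \<le> c * dt\<^sup>2" using dx dt elim(1) by (auto simp: h_def)
      have small: "c * dt \<le> 1" "c * dt \<le> m\<^sub>H" "Q * dt \<le> e"
        using dt(2) c(1) Q by (auto simp: \<delta>_def field_simps)
      have "c * dt * dt \<le> 1 * dt" "c * dt * dt \<le> m\<^sub>H * dt"
        using small dt by (intro mult_right_mono; simp)+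
      then have h': "h \<le> dt" "h \<le> m\<^sub>H * dt" using h(2) by (simp_all add: power2_eq_square)
      show ?case
      proof (intro allI impI)
        fix n x assume "real n \<le> T / dt"
        then have n: "real n * dt \<le> T" using dt by (simp add: pos_le_divide_eq)
        define U where "U = sl_scheme kind d l (\<epsilon> h) H v0 A b h dt n"
        have "{- K1..K1} \<subseteq> {- K..K}" using K12 by auto
        then have "{- K1..K1} \<subseteq> A" using A by blast
        then have err: "\<bar>U j - W (real n * dt) (node h j)\<bar> \<le> real n * (C * h)" for j
          using scheme_error[OF h(1) h' h(2) less_imp_le[OF c(1)] assms(10)[OF h(1)] d b _ _ n,
              of K1 A kind l] unfolding K1_def C_def U_def by blast
        have nt: "real n * dt \<ge> 0" using dt by simp
        have "\<bar>recon kind d l (\<epsilon> h) h U x - W (real n * dt) x\<bar> \<le> 5 * (real n * (C * h)) + 3 * L * h"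
          by (rule recon_close[OF h(1) assms(10)[OF h(1)] d W_lipschitz_x[OF nt] err])
        also have "\<dots> \<le> 5 * C * (T * c) * dt + 3 * L * dt"
        proof -
          have "real n * h \<le> real n * (c * dt\<^sup>2)" using h by (intro mult_left_mono) auto
          also have "\<dots> = c * (real n * dt) * dt" by (simp add: power2_eq_square algebra_simps)
          also have "\<dots> \<le> c * T * dt" using n c dt by (intro mult_right_mono mult_left_mono) auto
          finally have "5 * C * (real n * h) \<le> 5 * C * (c * T * dt)" using C by (intro mult_left_mono) auto
          moreover have "3 * L * h \<le> 3 * L * dt" using h' L_nonneg by (intro mult_left_mono) auto
          ultimately show ?thesis by (simp add: algebra_simps)
        qed
        also have "\<dots> \<le> Q * dt" using dt by (simp add: Q_def algebra_simps)
        also have "\<dots> \<le> e" by (rule small)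
        finally show "\<bar>recon kind d l (\<epsilon> (dx dt)) (dx dt)
                 (sl_scheme kind d l (\<epsilon> (dx dt)) H v0 A b (dx dt) dt n) x - v (real n * dt) x\<bar> \<le> e"
          using vW[of "real n * dt" x] n nt unfolding U_def h_def by simp
      qed
    qed
  qed simp
qed

end
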